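(* Let $\eta\in\mathbb{R}\setminus\{0\}$, let $\Lambda\subset\mathbb{R}^{2n}$ be a lattice and $\phi\in L^2(\mathbb{R}^n)$ be such that $\mathcal G_\eta(\phi,\Lambda)$ is a Gabor frame for $L^2(\mathbb{R}^n)$. Let $a\in L^2(\mathbb{R}^{2n})$ be real-valued and $\widehat A_\eta=\operatorname{Op}^{\mathrm W}_\eta(a)$. For $\lambda,\mu\in\Lambda$ put $$a_{\lambda,\mu}=\int_{\mathbb{R}^{2n}}e^{-\frac{i}{\eta}\sigma(z,\lambda-\mu)}a(z)\,W_\eta\phi\big(z-\tfrac12(\lambda+\mu)\big)\,dz,\qquad M_{\lambda,\mu}=e^{-\frac{i}{2\eta}\sigma(\lambda,\mu)}a_{\lambda,\mu}.$$ (i) $\widehat A_\eta\ge0$ if and only if for every integer $N\ge0$ the finite matrix $M_{(N)}=(M_{\lambda,\mu})_{\lambda,\mu\in\Lambda,\ |\lambda|,|\mu|\le N}$ is positive semidefinite. (ii) The same equivalence holds if $M_{(N)}$ is replaced by the matrix $M'_{(N)}=(M'_{\lambda,\mu})_{\lambda,\mu\in\Lambda,\ |\lambda|,|\mu|\le N}$ with $M'_{\lambda,\mu}=W_\eta\big(a,(W_\eta\phi)^\vee\big)\big(\tfrac14(\lambda+\mu),\tfrac12J(\mu-\lambda)\big)$, where $(W_\eta\phi)^\vee(z)=W_\eta\phi(-z)$ and $W_\eta(a,(W_\eta\phi)^\vee)$ is the $\eta$-cross-Wigner transform of these two functions on $\mathbb{R}^{2n}$ (a function on $\mathbb{R}^{2n}\times\mathbb{R}^{2n}$);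 indeed $M'_{\lambda,\mu}$ is a fixed positive constant (independent of $\lambda,\mu$) times $M_{\lambda,\mu}$.
   Context: Points of $\mathbb{R}^{2n}$ are written $z=(x,p)$. $J=\begin{pmatrix}0&I_n\\-I_n&0\end{pmatrix}$, $\sigma(z,z')=Jz\cdot z'=p\cdot x'-p'\cdot x$. $(\psi|\phi)_{L^2}=\int\psi\overline\phi$. For $\eta\ne0$ and functions on $\mathbb{R}^d$ (here $d=n$ or $d=2n$), the $\eta$-cross-Wigner transform is $W_\eta(f,g)(X,P)=(2\pi\eta)^{-d}\int_{\mathbb{R}^d}e^{-\frac{i}{\eta}P\cdot Y}f(X+\tfrac12Y)\overline{g(X-\tfrac12Y)}\,dY$, $(X,P)\in\mathbb{R}^d\times\mathbb{R}^d$, and $W_\eta f=W_\eta(f,f)$. The Weyl operator $\operatorname{Op}^{\mathrm W}_\eta(a)$ is defined by $\langle\operatorname{Op}^{\mathrm W}_\eta(a)\psi,\overline\phi\rangle=\langle a,W_\eta(\psi,\phi)\rangle$ for Schwartz $\psi,\phi$; for $a\in L^2(\mathbb{R}^{2n})$ it is a bounded (Hilbert–Schmidt) operator on $L^2(\mathbb{R}^n)$ and $(\operatorname{Op}^{\mathrm W}_\eta(a)\psi|\psi)_{L^2}=\int a\,W_\eta\psi$. $\widehat A\ge0$ means $(\widehat A\psi|\psi)_{L^2}\ge0$ for all $\psi\in L^2(\mathbb{R}^n)$. The Heisenberg $\eta$-displacement operator is $T_\eta(z_0)\psi(x)=e^{\frac{i}{\eta}(p_0\cdot x-\frac12p_0\cdot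 x_0)}\psi(x-x_0)$ for $z_0=(x_0,p_0)$. $\mathcal G_\eta(\phi,\Lambda)=\{T_\eta(\lambda)\phi:\lambda\in\Lambda\}$ is a Gabor frame if there are $0<A\le B$ with $A\|f\|_2^2\le\sum_{\lambda\in\Lambda}|(f|T_\eta(\lambda)\phi)_{L^2}|^2\le B\|f\|_2^2$ for all $f\in L^2(\mathbb{R}^n)$. A matrix $(M_{\lambda,\mu})$ is positive semidefinite if $\sum_{\lambda,\mu}\zeta_\lambda\overline{\zeta_\mu}M_{\lambda,\mu}\ge0$ for all complex vectors $\zeta$. *)

theory Defs
  imports "HOL-Analysis.Analysis"
begin

definition l2fun :: "('a::euclidean_space \<Rightarrow> complex) \<Rightarrow> bool" where
  "l2fun f \<longleftrightarrow> f \<in> borel_measurable lborel \<and> integrable lborel (\<lambda>x. (cmod (f x))\<^sup>2)"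

definition l2_inner :: "('a::euclidean_space \<Rightarrow> complex) \<Rightarrow> ('a \<Rightarrow> complex) \<Rightarrow> complex" where
  "l2_inner f g = integral\<^sup>L lborel (\<lambda>x. f x * cnj (g x))"

definition l2_normsq :: "('a::euclidean_space \<Rightarrow> complex) \<Rightarrow> real" where
  "l2_normsq f = integral\<^sup>L lborel (\<lambda>x. (cmod (f x))\<^sup>2)"

definition cnonneg :: "complex \<Rightarrow> bool" where
  "cnonneg z \<longleftrightarrow> Im z = 0 \<and> 0 \<le> Re z"

definition sympl :: "(real^'n) \<times> (real^'n) \<Rightarrow> (real^'n) \<times> (real^'n) \<Rightarrow> real" where
  "sympl z z' = snd z \<bullet> fst z' - snd z' \<bullet> fst z"

definition symp_J :: "(real^'n) \<times> (real^'n) \<Rightarrow> (real^'n) \<times> (real^'n)" where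
  "symp_J z = (snd z, - fst z)"

definition wigner :: "real \<Rightarrow> ('a::euclidean_space \<Rightarrow> complex) \<Rightarrow> ('a \<Rightarrow> complex) \<Rightarrow> 'a \<Rightarrow> 'a \<Rightarrow> complex" where
  "wigner \<eta> f g X P =
     (1 / complex_of_real ((2 * pi * \<eta>) ^ DIM('a))) *
     integral\<^sup>L lborel (\<lambda>Y. exp (- \<i> * complex_of_real ((P \<bullet> Y) / \<eta>)) *
        f (X + (1/2) *\<^sub>R Y) * cnj (g (X - (1/2) *\<^sub>R Y)))"

definition wig :: "real \<Rightarrow> ('a::euclidean_space \<Rightarrow> complex) \<Rightarrow> 'a \<times> 'a \<Rightarrow> complex" where
  "wig \<eta> f z = wigner \<eta> f f (fst z) (snd z)"

text \<open>(Op_eta(a) psi | psi) = integral of a * W_eta psi, for a in L2(R^2n).\<close>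
definition weyl_form :: "real \<Rightarrow> ((real^'n) \<times> (real^'n) \<Rightarrow> complex) \<Rightarrow> ((real^'n) \<Rightarrow> complex) \<Rightarrow> complex" where
  "weyl_form \<eta> a \<psi> = integral\<^sup>L lborel (\<lambda>z. a z * wig \<eta> \<psi> z)"

definition weyl_nonneg :: "real \<Rightarrow> ((real^'n) \<times> (real^'n) \<Rightarrow> complex) \<Rightarrow> bool" where
  "weyl_nonneg \<eta> a \<longleftrightarrow> (\<forall>\<psi>. l2fun \<psi> \<longrightarrow> cnonneg (weyl_form \<eta> a \<psi>))"

definition lattice :: "'a::euclidean_space set \<Rightarrow> bool" where
  "lattice L \<longleftrightarrow> (\<exists>B. independent B \<and> span B = UNIV \<and>
      L = range (\<lambda>k::'a \<Rightarrow> int. \<Sum>b\<in>B. of_int (k b) *\<^sub>R b))"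

definition heis :: "real \<Rightarrow> (real^'n) \<times> (real^'n) \<Rightarrow> ((real^'n) \<Rightarrow> complex) \<Rightarrow> (real^'n) \<Rightarrow> complex" where
  "heis \<eta> z0 \<psi> x =
     exp (\<i> * complex_of_real ((snd z0 \<bullet> x - (1/2) * (snd z0 \<bullet> fst z0)) / \<eta>)) * \<psi> (x - fst z0)"

definition gabor_frame :: "real \<Rightarrow> ((real^'n) \<Rightarrow> complex) \<Rightarrow> ((real^'n) \<times> (real^'n)) set \<Rightarrow> bool" where
  "gabor_frame \<eta> \<phi> \<Lambda> \<longleftrightarrow> (\<exists>A B::real. 0 < A \<and> A \<le> B \<and>
     (\<forall>f. l2fun f \<longrightarrow>
        (\<lambda>l. (cmod (l2_inner f (heis \<eta> l \<phi>)))\<^sup>2) summable_on \<Lambda> \<and>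
        A * l2_normsq f \<le> (\<Sum>\<^sub>\<infinity>l\<in>\<Lambda>. (cmod (l2_inner f (heis \<eta> l \<phi>)))\<^sup>2) \<and>
        (\<Sum>\<^sub>\<infinity>l\<in>\<Lambda>. (cmod (l2_inner f (heis \<eta> l \<phi>)))\<^sup>2) \<le> B * l2_normsq f))"

definition psd_on :: "'i set \<Rightarrow> ('i \<Rightarrow> 'i \<Rightarrow> complex) \<Rightarrow> bool" where
  "psd_on S M \<longleftrightarrow> (\<forall>\<zeta>::'i \<Rightarrow> complex.
      cnonneg (\<Sum>l\<in>S. \<Sum>m\<in>S. \<zeta> l * cnj (\<zeta> m) * M l m))"

definition coef_a :: "real \<Rightarrow> ((real^'n) \<times> (real^'n) \<Rightarrow> real) \<Rightarrow> ((real^'n) \<Rightarrow> complex)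
    \<Rightarrow> (real^'n) \<times> (real^'n) \<Rightarrow> (real^'n) \<times> (real^'n) \<Rightarrow> complex" where
  "coef_a \<eta> a \<phi> l m = integral\<^sup>L lborel (\<lambda>z.
      exp (- \<i> * complex_of_real (sympl z (l - m) / \<eta>)) * complex_of_real (a z) *
      wig \<eta> \<phi> (z - (1/2) *\<^sub>R (l + m)))"

definition matM :: "real \<Rightarrow> ((real^'n) \<times> (real^'n) \<Rightarrow> real) \<Rightarrow> ((real^'n) \<Rightarrow> complex)
    \<Rightarrow> (real^'n) \<times> (real^'n) \<Rightarrow> (real^'n) \<times> (real^'n) \<Rightarrow> complex" where
  "matM \<eta> a \<phi> l m = exp (- \<i> * complex_of_real (sympl l m / (2 * \<eta>))) * coef_a \<eta> a \<phi> l m"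

definition matM' :: "real \<Rightarrow> ((real^'n) \<times> (real^'n) \<Rightarrow> real) \<Rightarrow> ((real^'n) \<Rightarrow> complex)
    \<Rightarrow> (real^'n) \<times> (real^'n) \<Rightarrow> (real^'n) \<times> (real^'n) \<Rightarrow> complex" where
  "matM' \<eta> a \<phi> l m =
     wigner \<eta> (\<lambda>z. complex_of_real (a z)) (\<lambda>z. wig \<eta> \<phi> (- z))
       ((1/4) *\<^sub>R (l + m)) ((1/2) *\<^sub>R symp_J (m - l))"

end

theory Submission
  imports Defs "HOL-Probability.Characteristic_Functions"
begin

text \<open>
  The covariance of the cross-Wigner transform under displacements shows that \<open>matM \<eta> a \<phi> l m\<close> is the
  sesquilinear Weyl form \<open>\<integral> a W(T(l)\<phi>, T(m)\<phi>)\<close>, so positive semidefiniteness of the finite sections means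
  that the Weyl form is nonnegative on the finite linear combinations of the frame. These are dense in
  \<open>L\<^sup>2\<close>, and the Weyl form is \<open>L\<^sup>2\<close>-continuous because \<open>W\<close> is bounded from \<open>L\<^sup>2 \<times> L\<^sup>2\<close> to \<open>L\<^sup>2\<close>; for this only the
  inequality half of Plancherel's theorem is needed, which follows by Gaussian regularisation and Fatou's
  lemma. The substitution \<open>z = (l + m) / 4 + Y / 2\<close> turns the integral defining \<open>matM\<close> into \<open>matM'\<close>.
\<close>

subsection \<open>Lebesgue integrals on Euclidean spaces\<close>

text \<open>The obstacle in the Plancherel bound is that the Fourier transform of an integrable
  function is bounded but not known to be square-integrable. Writing its squared modulus as a double
  integral and exchanging the order with the frequency integral is therefore not absolutely
  convergent. A Gaussian weight in the frequency repairs this, and its Fourier transform is a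
  Gaussian whose mass is the same for every width, so the estimate survives removal of the weight.
  The operator itself never appears: it is represented by its sesquilinear form. The phase exp(-i
  sigma(l,m) / (2 \<eta>)) in \<open>matM\<close> is what remains when W(T(l)\<phi>, T(m)\<phi>) is
  recentred at the midpoint (l + m) / 2, and it is exactly what makes the entries values of this
  form. The lattice enters through its balls: each is finite, and together they exhaust \<Lambda>,
  so every finite combination of frame elements is tested by some finite section. Passing from these
  combinations to all of L^2 then uses that the nonnegative reals are closed in the complex
  plane.\<close>

lemma borel_measurable_cnj [measurable]:
  "f \<in> borel_measurable M \<Longrightarrow> (\<lambda>x. cnj (f x)) \<in> borel_measurable M"
  by (rule borel_measurable_continuous_on[OF continuous_on_cnj[OF continuous_on_id]])

lemma nn_integral_lborel_affine:
  fixes f :: "'a::euclidean_space \<Rightarrow> ennreal"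
  assumes [measurable]: "f \<in> borel_measurable borel" and "c \<noteq> 0"
  shows "(\<integral>\<^sup>+x. f x \<partial>lborel) = ennreal (\<bar>c\<bar> ^ DIM('a)) * (\<integral>\<^sup>+x. f (t + c *\<^sub>R x) \<partial>lborel)"
  by (subst lborel_affine[OF \<open>c \<noteq> 0\<close>, of t])
     (simp add: nn_integral_density nn_integral_distr nn_integral_cmult)

lemma nn_integral_lborel_fst:
  fixes f :: "'a::euclidean_space \<times> 'b::euclidean_space \<Rightarrow> ennreal"
  assumes "f \<in> borel_measurable (borel \<Otimes>\<^sub>M borel)"
  shows "(\<integral>\<^sup>+z. f z \<partial>lborel) = (\<integral>\<^sup>+x. \<integral>\<^sup>+y. f (x, y) \<partial>lborel \<partial>lborel)"
  using lborel.nn_integral_fst[of f lborel] assms by (simp add: lborel_prod borel_prod)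

lemma nn_integral_lborel_snd:
  fixes f :: "'a::euclidean_space \<times> 'b::euclidean_space \<Rightarrow> ennreal"
  assumes "f \<in> borel_measurable (borel \<Otimes>\<^sub>M borel)"
  shows "(\<integral>\<^sup>+z. f z \<partial>lborel) = (\<integral>\<^sup>+y. \<integral>\<^sup>+x. f (x, y) \<partial>lborel \<partial>lborel)"
  using lborel_pair.nn_integral_snd[of f] assms by (simp add: lborel_prod borel_prod)

text \<open>If \<open>f\<close> is not integrable, neither is its affine pullback, and both
  integrals take the default value 0. Measurability is thus the only condition on \<open>f\<close>,
  which lets \<open>cnj_wigner\<close> and \<open>wigner_heis\<close> be proved for merely Borel
  functions.\<close>

lemma integral_lborel_affine:
  fixes f :: "'a::euclidean_space \<Rightarrow> 'b::{banach, second_countable_topology}"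
  assumes [measurable]: "f \<in> borel_measurable borel" and "c \<noteq> 0"
  shows "(\<integral>x. f x \<partial>lborel) = \<bar>c\<bar> ^ DIM('a) *\<^sub>R (\<integral>x. f (t + c *\<^sub>R x) \<partial>lborel)"
  by (subst lborel_affine[OF \<open>c \<noteq> 0\<close>, of t]) (simp add: integral_density integral_distr)

lemma integrable_lborel_affine:
  fixes f :: "'a::euclidean_space \<Rightarrow> 'b::{banach, second_countable_topology}"
  assumes f: "integrable lborel f" and "c \<noteq> 0"
  shows "integrable lborel (\<lambda>x. f (t + c *\<^sub>R x))"
proof -
  have [measurable]: "f \<in> borel_measurable borel"
    using borel_measurable_integrable[OF f] by simp
  have "integrable (density (distr lborel borel (\<lambda>x. t + c *\<^sub>R x)) (\<lambda>_. \<bar>c\<bar> ^ DIM('a))) f"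
    using f by (subst (asm) lborel_affine[OF \<open>c \<noteq> 0\<close>, of t])
  then have "integrable lborel (\<lambda>x. \<bar>c\<bar> ^ DIM('a) *\<^sub>R f (t + c *\<^sub>R x))"
    by (simp add: integrable_density integrable_distr_eq)
  then have "integrable lborel (\<lambda>x. inverse (\<bar>c\<bar> ^ DIM('a)) *\<^sub>R \<bar>c\<bar> ^ DIM('a) *\<^sub>R f (t + c *\<^sub>R x))"
    by (rule integrable_scaleR_right)
  then show ?thesis
    using \<open>c \<noteq> 0\<close> by simp
qed

section \<open>Fourier transforms of Gaussians\<close>

lemma
  fixes f :: "'a::euclidean_space \<Rightarrow> real \<Rightarrow> complex"
  assumes f: "\<And>b. b \<in> Basis \<Longrightarrow> integrable lborel (f b)"
  shows integrable_lborel_prod: "integrable lborel (\<lambda>x. \<Prod>b\<in>Basis. f b (x \<bullet> b))"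
    and integral_lborel_prod:
      "(\<integral>x. (\<Prod>b\<in>Basis. f b (x \<bullet> b)) \<partial>lborel) = (\<Prod>b\<in>Basis. \<integral>x. f b x \<partial>lborel)"
proof -
  interpret product_sigma_finite "\<lambda>_::'a. lborel :: real measure"
    by standard
  have [measurable]: "f b \<in> borel_measurable borel" if "b \<in> Basis" for b
    using borel_measurable_integrable[OF f[OF that]] by simp
  have eq: "(\<Prod>b\<in>Basis. f b ((\<Sum>c\<in>Basis. x c *\<^sub>R c) \<bullet> b)) = (\<Prod>b\<in>Basis. f b (x b))"
    for x :: "'a \<Rightarrow> real"
    by (rule prod.cong) (simp_all add: inner_sum_left_Basis)
  show "integrable lborel (\<lambda>x. \<Prod>b\<in>Basis. f b (x \<bullet> b))"
    using product_integrable_prod[of Basis f] f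
    by (subst lborel_eq) (simp add: integrable_distr_eq eq)
  show "(\<integral>x. (\<Prod>b\<in>Basis. f b (x \<bullet> b)) \<partial>lborel) = (\<Prod>b\<in>Basis. \<integral>x. f b x \<partial>lborel)"
    using product_integral_prod[of Basis f] f
    by (subst lborel_eq) (simp add: integral_distr eq)
qed

text \<open>The substitution of \<open>e * p\<close> for the variable turns this into the
  characteristic function of the standard normal distribution at \<open>y / e\<close>.\<close>

lemma
  fixes y e :: real
  assumes "e > 0"
  shows integrable_gaussian_real:
      "integrable lborel (\<lambda>p. exp (\<i> * complex_of_real (y * p)) * complex_of_real (exp (- (e * p)\<^sup>2 / 2)))"
    and fourier_gaussian_real:
      "(\<integral>p. exp (\<i> * complex_of_real (y * p)) * complex_of_real (exp (- (e * p)\<^sup>2 / 2)) \<partial>lborel)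
        = complex_of_real (sqrt (2 * pi) / e * exp (- (y / e)\<^sup>2 / 2))"
proof -
  define F where "F = (\<lambda>x::real. exp (\<i> * complex_of_real (y / e * x)) * complex_of_real (std_normal_density x))"
  have "integrable lborel (\<lambda>x. complex_of_real (std_normal_density x))"
    by (intro integrable_of_real integrable_normal_density) simp
  then have F: "integrable lborel F"
    unfolding F_def
    by (rule Bochner_Integration.integrable_bound) (auto simp: norm_mult intro!: AE_I2)
  have "char std_normal_distribution (y / e) = integral\<^sup>L lborel F"
    unfolding char_def F_def by (subst integral_density) (auto simp: scaleR_conv_of_real mult.commute)
  then have intF: "integral\<^sup>L lborel F = complex_of_real (exp (- (y / e)\<^sup>2 / 2))"
    by (simp add: char_std_normal_distribution)
  have eq: "exp (\<i> * complex_of_real (y * p)) * complex_of_real (exp (- (e * p)\<^sup>2 / 2))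
      = complex_of_real (sqrt (2 * pi)) * F (0 + e * p)" for p
    using assms unfolding F_def std_normal_density_def
    by (simp add: field_simps)
  show "integrable lborel (\<lambda>p. exp (\<i> * complex_of_real (y * p)) * complex_of_real (exp (- (e * p)\<^sup>2 / 2)))"
    unfolding eq using lborel_integrable_real_affine[OF F, of e 0] assms by simp
  have "complex_of_real e * (\<integral>p. F (0 + e * p) \<partial>lborel) = integral\<^sup>L lborel F"
    using lborel_integral_real_affine[of e F 0] assms by (simp add: scaleR_conv_of_real)
  then have "(\<integral>p. F (0 + e * p) \<partial>lborel) = complex_of_real (exp (- (y / e)\<^sup>2 / 2)) / complex_of_real e"
    using assms intF by (simp add: field_simps)
  then show "(\<integral>p. exp (\<i> * complex_of_real (y * p)) * complex_of_real (exp (- (e * p)\<^sup>2 / 2)) \<partial>lborel)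
        = complex_of_real (sqrt (2 * pi) / e * exp (- (y / e)\<^sup>2 / 2))"
    unfolding eq by (simp add: field_simps)
qed

text \<open>The inner product and the squared norm are sums over \<open>Basis\<close>, so the
  integrand is a product of one-dimensional ones and the integral factorises.\<close>

lemma
  fixes y :: "'a::euclidean_space"
  assumes "e > 0"
  shows integrable_gaussian:
      "integrable lborel (\<lambda>p. exp (\<i> * complex_of_real (y \<bullet> p)) * complex_of_real (exp (- (e * norm p)\<^sup>2 / 2)))"
    and fourier_gaussian:
      "(\<integral>p. exp (\<i> * complex_of_real (y \<bullet> p)) * complex_of_real (exp (- (e * norm p)\<^sup>2 / 2)) \<partial>lborel)
        = complex_of_real ((sqrt (2 * pi) / e) ^ DIM('a) * exp (- (norm y / e)\<^sup>2 / 2))"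
proof -
  let ?f = "\<lambda>b::'a. \<lambda>p. exp (\<i> * complex_of_real ((y \<bullet> b) * p)) * complex_of_real (exp (- (e * p)\<^sup>2 / 2))"
  have nrm: "(norm p)\<^sup>2 = (\<Sum>b\<in>Basis. (p \<bullet> b)\<^sup>2)" for p :: 'a
    unfolding power2_norm_eq_inner by (subst euclidean_inner) (simp add: power2_eq_square)
  have expn: "exp (- (c * norm p)\<^sup>2 / 2) = (\<Prod>b\<in>Basis. exp (- (c * (p \<bullet> b))\<^sup>2 / 2))" for p :: 'a and c :: real
    by (simp add: exp_sum[symmetric] power_mult_distrib nrm sum_distrib_left sum_negf sum_divide_distrib)
  have expi: "exp (\<i> * complex_of_real (y \<bullet> p)) = (\<Prod>b\<in>Basis. exp (\<i> * complex_of_real ((y \<bullet> b) * (p \<bullet> b))))" for p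
    by (simp add: exp_sum[symmetric] euclidean_inner[of y p] sum_distrib_left)
  have eq: "exp (\<i> * complex_of_real (y \<bullet> p)) * complex_of_real (exp (- (e * norm p)\<^sup>2 / 2))
     = (\<Prod>b\<in>Basis. ?f b (p \<bullet> b))" for p
    by (simp only: expi expn of_real_prod prod.distrib)
  show "integrable lborel (\<lambda>p. exp (\<i> * complex_of_real (y \<bullet> p)) * complex_of_real (exp (- (e * norm p)\<^sup>2 / 2)))"
    unfolding eq by (rule integrable_lborel_prod) (rule integrable_gaussian_real[OF assms])
  have "(\<integral>p. (\<Prod>b\<in>Basis. ?f b (p \<bullet> b)) \<partial>lborel) = (\<Prod>b\<in>Basis. \<integral>x. ?f b x \<partial>lborel)"
    by (rule integral_lborel_prod) (rule integrable_gaussian_real[OF assms])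
  also have "\<dots> = (\<Prod>b\<in>(Basis::'a set). complex_of_real (sqrt (2 * pi) / e * exp (- ((y \<bullet> b) / e)\<^sup>2 / 2)))"
    by (simp only: fourier_gaussian_real[OF assms])
  also have "\<dots> = complex_of_real ((sqrt (2 * pi) / e) ^ DIM('a) * exp (- (norm y / e)\<^sup>2 / 2))"
    using expn[of "1 / e" y] by (simp only: prod.distrib of_real_prod[symmetric] prod_constant) simp
  finally show "(\<integral>p. exp (\<i> * complex_of_real (y \<bullet> p)) * complex_of_real (exp (- (e * norm p)\<^sup>2 / 2)) \<partial>lborel)
        = complex_of_real ((sqrt (2 * pi) / e) ^ DIM('a) * exp (- (norm y / e)\<^sup>2 / 2))"
    unfolding eq .
qed


lemma
  fixes f :: "'a::euclidean_space \<Rightarrow> complex" and g :: "'b::euclidean_space \<Rightarrow> complex"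
  assumes f: "integrable lborel f" and g: "integrable lborel g"
  shows integrable_lborel_tensor: "integrable lborel (\<lambda>(x, y). f x * g y)"
    and integral_lborel_tensor:
      "(\<integral>z. (case z of (x, y) \<Rightarrow> f x * g y) \<partial>lborel) = (\<integral>x. f x \<partial>lborel) * (\<integral>y. g y \<partial>lborel)"
proof -
  have [measurable]: "f \<in> borel_measurable borel" "g \<in> borel_measurable borel"
    using borel_measurable_integrable[OF f] borel_measurable_integrable[OF g] by simp_all
  have int: "integrable (lborel \<Otimes>\<^sub>M lborel) (\<lambda>(x, y). f x * g y)"
  proof (rule lborel_pair.Fubini_integrable)
    have "integrable lborel (\<lambda>x. cmod (f x) * (\<integral>y. cmod (g y) \<partial>lborel))"
      using f by (intro integrable_mult_left integrable_norm)
    then show "integrable lborel (\<lambda>x. \<integral>y. cmod (case (x, y) of (x, y) \<Rightarrow> f x * g y) \<partial>lborel)"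
      by (simp add: norm_mult)
  qed (use g in \<open>simp_all add: split_beta'\<close>)
  then show "integrable lborel (\<lambda>(x, y). f x * g y)"
    by (simp add: lborel_prod)
  show "(\<integral>z. (case z of (x, y) \<Rightarrow> f x * g y) \<partial>lborel) = (\<integral>x. f x \<partial>lborel) * (\<integral>y. g y \<partial>lborel)"
    using lborel_pair.integral_fst'[OF int] by (simp add: lborel_prod)
qed

text \<open>This is \<open>fourier_gaussian\<close> at frequency 0 with \<open>1 / e\<close> for
  \<open>e\<close>. The mass does not depend on \<open>e\<close>, which makes the bound of
  \<open>plancherel_le_gaussian\<close> uniform in the regularisation.\<close>

lemma nn_integral_gaussian:
  assumes "e > 0"
  shows "(\<integral>\<^sup>+y. ennreal ((sqrt (2 * pi) / e) ^ DIM('a) * exp (- (norm y / e)\<^sup>2 / 2)) \<partial>(lborel :: 'a::euclidean_space measure))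
    = ennreal ((2 * pi) ^ DIM('a))"
proof -
  let ?G = "\<lambda>y::'a. exp (- (1 / e * norm y)\<^sup>2 / 2)"
  have e: "1 / e > 0"
    using assms by simp
  have int: "integrable lborel ?G"
    using integrable_gaussian[OF e, of "0::'a"]
    by (simp only: inner_zero_left of_real_0 mult_zero_right exp_zero mult_1_left complex_of_real_integrable_eq)
  have "complex_of_real (integral\<^sup>L lborel ?G) = complex_of_real ((sqrt (2 * pi) * e) ^ DIM('a))"
    using fourier_gaussian[OF e, of "0::'a"] by (simp only: inner_zero_left) (simp del: of_real_exp)
  then have val: "integral\<^sup>L lborel ?G = (sqrt (2 * pi) * e) ^ DIM('a)"
    by (simp only: of_real_eq_iff)
  have "(\<integral>\<^sup>+y. ennreal ((sqrt (2 * pi) / e) ^ DIM('a) * exp (- (norm y / e)\<^sup>2 / 2)) \<partial>(lborel :: 'a measure))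
     = (\<integral>\<^sup>+y. ennreal ((sqrt (2 * pi) / e) ^ DIM('a)) * ennreal (?G y) \<partial>lborel)"
    using assms by (simp add: ennreal_mult)
  also have "\<dots> = ennreal ((sqrt (2 * pi) / e) ^ DIM('a)) * ennreal (integral\<^sup>L lborel ?G)"
    by (subst nn_integral_cmult) (use nn_integral_eq_integral[OF int] in auto)
  also have "\<dots> = ennreal ((sqrt (2 * pi) / e) ^ DIM('a) * (sqrt (2 * pi) * e) ^ DIM('a))"
    unfolding val using assms by (simp add: ennreal_mult)
  also have "(sqrt (2 * pi) / e) ^ DIM('a) * (sqrt (2 * pi) * e) ^ DIM('a) = (2 * pi) ^ DIM('a)"
    unfolding power_mult_distrib[symmetric] using assms by simp
  finally show ?thesis .
qed

subsection \<open>The Plancherel inequality\<close>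

text \<open>Integrating against a Gaussian turns the squared Fourier transform into a double integral
  of \<open>h y\<close> and \<open>cnj (h y')\<close> against a Gaussian in \<open>y' - y\<close> of total mass \<open>(2 * pi) ^ DIM('a)\<close>,
  which the inequality of arithmetic and geometric means reduces to the mass.\<close>

lemma plancherel_le_gaussian:
  fixes h :: "'a::euclidean_space \<Rightarrow> complex"
  assumes h: "integrable lborel h" and e: "e > 0"
  shows "(\<integral>\<^sup>+p. ennreal ((cmod (\<integral>y. exp (- \<i> * complex_of_real (p \<bullet> y)) * h y \<partial>lborel))\<^sup>2
            * exp (- (e * norm p)\<^sup>2 / 2)) \<partial>lborel)
    \<le> ennreal ((2 * pi) ^ DIM('a)) * (\<integral>\<^sup>+y. ennreal ((cmod (h y))\<^sup>2) \<partial>lborel)"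
proof -
  have [measurable]: "h \<in> borel_measurable borel"
    using borel_measurable_integrable[OF h] by simp
  define H where "H p = (\<integral>y. exp (- \<i> * complex_of_real (p \<bullet> y)) * h y \<partial>lborel)" for p
  define g where "g p = exp (- (e * norm p)\<^sup>2 / 2)" for p :: 'a
  define K where "K v = (sqrt (2 * pi) / e) ^ DIM('a) * exp (- (norm v / e)\<^sup>2 / 2)" for v :: 'a
  \<comment> \<open>Integrating \<open>\<Phi>\<close> over (y, y') first gives the weighted square
    of \<open>H\<close>, integrating over p first gives the kernel \<open>K\<close>. The factor
    \<open>g p\<close> makes \<open>\<Phi>\<close> absolutely integrable on the triple product, so
    Fubini applies.\<close>
  define \<Phi> where "\<Phi> = (\<lambda>(p, y, y'). exp (\<i> * complex_of_real ((y' - y) \<bullet> p)) * complex_of_real (g p)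
      * (h y * cnj (h y')))"
  have [measurable]: "g \<in> borel_measurable borel" "K \<in> borel_measurable borel"
    unfolding g_def K_def by measurable
  have K_nonneg: "K v \<ge> 0" for v
    using e by (simp add: K_def)
  have hh: "integrable lborel (\<lambda>(y, y'). h y * cnj (h y'))"
    by (rule integrable_lborel_tensor) (use h in auto)
  have int_g: "integrable lborel (\<lambda>p. complex_of_real (g p))"
    using integrable_gaussian[OF e, of "0::'a"] unfolding g_def by (simp only: inner_zero_left) (simp del: of_real_exp)
  have int_\<Phi>: "integrable (lborel \<Otimes>\<^sub>M lborel) \<Phi>"
  proof (rule Bochner_Integration.integrable_bound)
    show "integrable (lborel \<Otimes>\<^sub>M lborel) (\<lambda>(p, z). complex_of_real (g p) * (case z of (y, y') \<Rightarrow> h y * cnj (h y')))"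
      using integrable_lborel_tensor[OF int_g hh] by (simp add: lborel_prod)
    show "\<Phi> \<in> borel_measurable (lborel \<Otimes>\<^sub>M lborel)"
      unfolding \<Phi>_def lborel_prod[symmetric] by measurable
  qed (simp add: \<Phi>_def norm_mult split_beta')
  have tw: "integrable lborel (\<lambda>y. exp (\<i> * complex_of_real (s * (y \<bullet> p))) * h y)" for p s
    using h by (rule Bochner_Integration.integrable_bound) (auto simp: norm_mult)
  have fst: "(\<integral>z. \<Phi> (p, z) \<partial>lborel) = complex_of_real ((cmod (H p))\<^sup>2 * g p)" for p
  proof -
    have 1: "integrable lborel (\<lambda>y. exp (- \<i> * complex_of_real (p \<bullet> y)) * h y)"
      using tw[of "-1" p] by (simp add: inner_commute)
    have 2: "integrable lborel (\<lambda>y. cnj (exp (- \<i> * complex_of_real (p \<bullet> y)) * h y))"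
      using 1 by (simp only: integrable_cnj)
    \<comment> \<open>The character at y' - y splits into one at y and a conjugate one at y', so the
      inner double integral becomes \<open>H p * cnj (H p)\<close>.\<close>
    have eq: "exp (\<i> * complex_of_real ((y' - y) \<bullet> p))
        = exp (- \<i> * complex_of_real (p \<bullet> y)) * cnj (exp (- \<i> * complex_of_real (p \<bullet> y')))" for y y'
      by (simp add: exp_cnj mult_exp_exp inner_diff_left inner_diff_right inner_commute right_diff_distrib)
    have "(\<integral>z. \<Phi> (p, z) \<partial>lborel) = (\<integral>z. complex_of_real (g p) *
        (case z of (y, y') \<Rightarrow> (exp (- \<i> * complex_of_real (p \<bullet> y)) * h y) * cnj (exp (- \<i> * complex_of_real (p \<bullet> y')) * h y')) \<partial>lborel)"
      by (rule Bochner_Integration.integral_cong) (simp_all only: \<Phi>_def eq complex_cnj_mult split_beta' fst_conv snd_conv mult_ac)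
    also have "\<dots> = complex_of_real (g p) * (H p * cnj (H p))"
      unfolding integral_mult_right_zero integral_lborel_tensor[OF 1 2] Bochner_Integration.integral_cnj H_def ..
    finally show ?thesis
      by (simp add: complex_norm_square del: of_real_power)
  qed
  have snd: "(\<integral>p. \<Phi> (p, z) \<partial>lborel) = h (fst z) * cnj (h (snd z)) * complex_of_real (K (snd z - fst z))" for z
  proof -
    have "(\<integral>p. \<Phi> (p, z) \<partial>lborel) = (\<integral>p. h (fst z) * cnj (h (snd z)) *
        (exp (\<i> * complex_of_real ((snd z - fst z) \<bullet> p)) * complex_of_real (exp (- (e * norm p)\<^sup>2 / 2))) \<partial>lborel)"
      by (rule Bochner_Integration.integral_cong) (simp_all only: \<Phi>_def g_def split_beta' fst_conv snd_conv mult_ac)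
    then show ?thesis
      by (simp only: integral_mult_right_zero fourier_gaussian[OF e] K_def)
  qed
  have int_gH: "integrable lborel (\<lambda>p. (cmod (H p))\<^sup>2 * g p)"
    using lborel_pair.integrable_fst'[OF int_\<Phi>] unfolding fst by (simp only: complex_of_real_integrable_eq)
  have int_K: "integrable lborel (\<lambda>z. h (fst z) * cnj (h (snd z)) * complex_of_real (K (snd z - fst z)))"
    using lborel_pair.integrable_snd[of "\<lambda>p z. \<Phi> (p, z)"] int_\<Phi> unfolding snd by simp
  have "(\<integral>z. \<integral>p. \<Phi> (p, z) \<partial>lborel \<partial>lborel) = (\<integral>p. \<integral>z. \<Phi> (p, z) \<partial>lborel \<partial>lborel)"
    by (rule lborel_pair.Fubini_integral) (simp add: int_\<Phi>)
  then have "(\<integral>z. h (fst z) * cnj (h (snd z)) * complex_of_real (K (snd z - fst z)) \<partial>lborel)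
      = complex_of_real (\<integral>p. (cmod (H p))\<^sup>2 * g p \<partial>lborel)"
    unfolding fst snd integral_complex_of_real .
  \<comment> \<open>The kernel integral equals a nonnegative real number. Taking moduli therefore
    loses nothing on that side and allows the triangle inequality for integrals on the
    other.\<close>
  then have "cmod (\<integral>z. h (fst z) * cnj (h (snd z)) * complex_of_real (K (snd z - fst z)) \<partial>lborel)
      = \<bar>\<integral>p. (cmod (H p))\<^sup>2 * g p \<partial>lborel\<bar>"
    by (simp only: norm_of_real)
  moreover have "(\<integral>p. (cmod (H p))\<^sup>2 * g p \<partial>lborel) \<ge> 0"
    by (intro integral_nonneg_AE AE_I2) (simp add: g_def)
  ultimately have "ennreal (\<integral>p. (cmod (H p))\<^sup>2 * g p \<partial>lborel)
      \<le> (\<integral>\<^sup>+z. ennreal (cmod (h (fst z) * cnj (h (snd z)) * complex_of_real (K (snd z - fst z)))) \<partial>lborel)"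
    using integral_norm_bound_ennreal[OF int_K] by simp
  also have "\<dots> \<le> (\<integral>\<^sup>+z. ennreal ((cmod (h (fst z)))\<^sup>2 / 2) * ennreal (K (snd z - fst z))
       + ennreal ((cmod (h (snd z)))\<^sup>2 / 2) * ennreal (K (snd z - fst z)) \<partial>lborel)"
  proof (rule nn_integral_mono)
    fix z :: "'a \<times> 'a"
    let ?x = "cmod (h (fst z))" and ?y = "cmod (h (snd z))" and ?k = "K (snd z - fst z)"
    have "0 \<le> (?x - ?y)\<^sup>2"
      by simp
    then have "?x * ?y \<le> ?x\<^sup>2 / 2 + ?y\<^sup>2 / 2"
      by (simp add: power2_diff)
    then have "?x * ?y * ?k \<le> (?x\<^sup>2 / 2 + ?y\<^sup>2 / 2) * ?k"
      using K_nonneg by (rule mult_right_mono)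
    then have "?x * ?y * ?k \<le> ?x\<^sup>2 / 2 * ?k + ?y\<^sup>2 / 2 * ?k"
      by (simp only: distrib_right)
    then show "ennreal (cmod (h (fst z) * cnj (h (snd z)) * complex_of_real ?k))
        \<le> ennreal (?x\<^sup>2 / 2) * ennreal ?k + ennreal (?y\<^sup>2 / 2) * ennreal ?k"
      using K_nonneg[of "snd z - fst z"]
      by (simp add: norm_mult ennreal_mult[symmetric] ennreal_plus[symmetric] ennreal_leI del: ennreal_plus)
  qed
  also have "\<dots> = (\<integral>\<^sup>+z. ennreal ((cmod (h (fst z)))\<^sup>2 / 2) * ennreal (K (snd z - fst z)) \<partial>lborel)
       + (\<integral>\<^sup>+z. ennreal ((cmod (h (snd z)))\<^sup>2 / 2) * ennreal (K (snd z - fst z)) \<partial>lborel)"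
    unfolding lborel_prod[symmetric] by (rule nn_integral_add) measurable
  also have "(\<integral>\<^sup>+z. ennreal ((cmod (h (fst z)))\<^sup>2 / 2) * ennreal (K (snd z - fst z)) \<partial>lborel)
      = (\<integral>\<^sup>+y. \<integral>\<^sup>+y'. ennreal ((cmod (h y))\<^sup>2 / 2) * ennreal (K (y' - y)) \<partial>lborel \<partial>lborel)"
    by (subst nn_integral_lborel_fst) simp_all
  also have "\<dots> = (\<integral>\<^sup>+y. ennreal ((cmod (h y))\<^sup>2 / 2) * ennreal ((2 * pi) ^ DIM('a)) \<partial>lborel)"
  proof (rule nn_integral_cong)
    fix y :: 'a
    have "(\<integral>\<^sup>+y'. ennreal (K (y' - y)) \<partial>lborel) = ennreal ((2 * pi) ^ DIM('a))"
      using nn_integral_lborel_affine[of "\<lambda>y. ennreal (K y)" 1 "- y"] nn_integral_gaussian[OF e, where 'a='a]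
      by (simp add: K_def)
    then show "(\<integral>\<^sup>+y'. ennreal ((cmod (h y))\<^sup>2 / 2) * ennreal (K (y' - y)) \<partial>lborel)
        = ennreal ((cmod (h y))\<^sup>2 / 2) * ennreal ((2 * pi) ^ DIM('a))"
      by (simp add: nn_integral_cmult)
  qed
  also have "(\<integral>\<^sup>+z. ennreal ((cmod (h (snd z)))\<^sup>2 / 2) * ennreal (K (snd z - fst z)) \<partial>lborel)
      = (\<integral>\<^sup>+y'. \<integral>\<^sup>+y. ennreal ((cmod (h y'))\<^sup>2 / 2) * ennreal (K (y' - y)) \<partial>lborel \<partial>lborel)"
    by (subst nn_integral_lborel_snd) simp_all
  also have "\<dots> = (\<integral>\<^sup>+y. ennreal ((cmod (h y))\<^sup>2 / 2) * ennreal ((2 * pi) ^ DIM('a)) \<partial>lborel)"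
  proof (rule nn_integral_cong)
    fix y' :: 'a
    have "(\<integral>\<^sup>+y. ennreal (K (y' - y)) \<partial>lborel) = ennreal ((2 * pi) ^ DIM('a))"
      using nn_integral_lborel_affine[of "\<lambda>y. ennreal (K y)" "-1" y'] nn_integral_gaussian[OF e, where 'a='a]
      by (simp add: K_def)
    then show "(\<integral>\<^sup>+y. ennreal ((cmod (h y'))\<^sup>2 / 2) * ennreal (K (y' - y)) \<partial>lborel)
        = ennreal ((cmod (h y'))\<^sup>2 / 2) * ennreal ((2 * pi) ^ DIM('a))"
      by (simp add: nn_integral_cmult)
  qed
  also have "(\<integral>\<^sup>+y. ennreal ((cmod (h y))\<^sup>2 / 2) * ennreal ((2 * pi) ^ DIM('a)) \<partial>lborel)
      + (\<integral>\<^sup>+y. ennreal ((cmod (h y))\<^sup>2 / 2) * ennreal ((2 * pi) ^ DIM('a)) \<partial>lborel)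
      = (\<integral>\<^sup>+y. (ennreal ((cmod (h y))\<^sup>2 / 2) + ennreal ((cmod (h y))\<^sup>2 / 2)) * ennreal ((2 * pi) ^ DIM('a)) \<partial>lborel)"
    by (subst nn_integral_add[symmetric]) (simp_all add: distrib_right)
  also have "\<dots> = ennreal ((2 * pi) ^ DIM('a)) * (\<integral>\<^sup>+y. ennreal ((cmod (h y))\<^sup>2) \<partial>lborel)"
    by (simp add: ennreal_plus[symmetric] nn_integral_multc mult.commute del: ennreal_plus)
  finally have "ennreal (\<integral>p. (cmod (H p))\<^sup>2 * g p \<partial>lborel)
      \<le> ennreal ((2 * pi) ^ DIM('a)) * (\<integral>\<^sup>+y. ennreal ((cmod (h y))\<^sup>2) \<partial>lborel)" .
  moreover have "(\<integral>\<^sup>+p. ennreal ((cmod (H p))\<^sup>2 * g p) \<partial>lborel) = ennreal (\<integral>p. (cmod (H p))\<^sup>2 * g p \<partial>lborel)"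
    by (rule nn_integral_eq_integral[OF int_gH]) (simp add: g_def)
  ultimately show ?thesis
    unfolding H_def g_def by simp
qed

text \<open>The Gaussian weights tend pointwise to 1 while the bound stays fixed, so Fatou's lemma
  removes them. The statement lives in \<open>ennreal\<close> because an integrable \<open>h\<close>
  may have infinite L^2 norm.\<close>

lemma plancherel_le:
  fixes h :: "'a::euclidean_space \<Rightarrow> complex"
  assumes h: "integrable lborel h"
  shows "(\<integral>\<^sup>+p. ennreal ((cmod (\<integral>y. exp (- \<i> * complex_of_real (p \<bullet> y)) * h y \<partial>lborel))\<^sup>2) \<partial>lborel)
    \<le> ennreal ((2 * pi) ^ DIM('a)) * (\<integral>\<^sup>+y. ennreal ((cmod (h y))\<^sup>2) \<partial>lborel)"
proof -
  have [measurable]: "h \<in> borel_measurable borel"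
    using borel_measurable_integrable[OF h] by simp
  define H where "H p = (\<integral>y. exp (- \<i> * complex_of_real (p \<bullet> y)) * h y \<partial>lborel)" for p
  \<comment> \<open>The width parameter is 1 / (k + 1): it tends to 0 and is positive already at k =
    0.\<close>
  define u where "u k p = ennreal ((cmod (H p))\<^sup>2 * exp (- (inverse (real (Suc k)) * norm p)\<^sup>2 / 2))" for k p
  have [measurable]: "H \<in> borel_measurable borel"
    unfolding H_def by measurable
  have lim: "liminf (\<lambda>k. u k p) = ennreal ((cmod (H p))\<^sup>2)" for p
  proof (rule lim_imp_Liminf)
    have "(\<lambda>k. (cmod (H p))\<^sup>2 * exp (- (inverse (real (Suc k)) * norm p)\<^sup>2 / 2))
        \<longlonglongrightarrow> (cmod (H p))\<^sup>2 * exp (- (0 * norm p)\<^sup>2 / 2)"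
      by (intro tendsto_intros LIMSEQ_inverse_real_of_nat) simp_all
    then show "(\<lambda>k. u k p) \<longlonglongrightarrow> ennreal ((cmod (H p))\<^sup>2)"
      unfolding u_def by (intro tendsto_ennrealI) simp
  qed simp
  have "(\<integral>\<^sup>+p. liminf (\<lambda>k. u k p) \<partial>lborel) \<le> liminf (\<lambda>k. integral\<^sup>N lborel (u k))"
    by (rule nn_integral_liminf) (simp add: u_def)
  also have "\<dots> \<le> liminf (\<lambda>k. ennreal ((2 * pi) ^ DIM('a)) * (\<integral>\<^sup>+y. ennreal ((cmod (h y))\<^sup>2) \<partial>lborel))"
  proof (intro Liminf_mono always_eventually allI)
    show "integral\<^sup>N lborel (u k) \<le> ennreal ((2 * pi) ^ DIM('a)) * (\<integral>\<^sup>+y. ennreal ((cmod (h y))\<^sup>2) \<partial>lborel)" for k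
      using plancherel_le_gaussian[OF h, of "inverse (real (Suc k))"] unfolding u_def H_def by simp
  qed
  finally show ?thesis
    unfolding lim by (simp add: H_def Liminf_const)
qed

subsection \<open>Square-integrable functions\<close>

lemma l2fun_borel_measurable: "l2fun f \<Longrightarrow> f \<in> borel_measurable borel"
  by (simp add: l2fun_def)

lemma l2_normsq_nonneg: "l2_normsq f \<ge> 0"
  unfolding l2_normsq_def by (rule integral_nonneg_AE) simp

lemma nn_integral_l2_normsq:
  "l2fun f \<Longrightarrow> (\<integral>\<^sup>+x. ennreal ((cmod (f x))\<^sup>2) \<partial>lborel) = ennreal (l2_normsq f)"
  unfolding l2fun_def l2_normsq_def by (intro nn_integral_eq_integral) auto

lemma l2funI_bounded:
  assumes [measurable]: "f \<in> borel_measurable borel"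
    and le: "(\<integral>\<^sup>+x. ennreal ((cmod (f x))\<^sup>2) \<partial>lborel) \<le> ennreal c" and "c \<ge> 0"
  shows "l2fun f" and "l2_normsq f \<le> c"
proof -
  have "(\<integral>\<^sup>+x. ennreal ((cmod (f x))\<^sup>2) \<partial>lborel) < \<infinity>"
    using le by (rule order.strict_trans1) simp
  then show f: "l2fun f"
    unfolding l2fun_def by (auto intro!: integrableI_nonneg)
  show "l2_normsq f \<le> c"
    using le \<open>c \<ge> 0\<close> unfolding nn_integral_l2_normsq[OF f] by simp
qed

lemma l2fun_cnj: "l2fun f \<Longrightarrow> l2fun (\<lambda>x. cnj (f x))"
  by (auto simp: l2fun_def intro: borel_measurable_cnj)

lemma l2fun_cmult: "l2fun f \<Longrightarrow> l2fun (\<lambda>x. c * f x)"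
  by (auto simp: l2fun_def norm_mult power_mult_distrib)

lemma l2fun_unimodular:
  assumes "l2fun f" and "u \<in> borel_measurable borel" and "\<And>x. cmod (u x) = 1"
  shows "l2fun (\<lambda>x. u x * f x)"
  using assms by (auto simp: l2fun_def norm_mult)

lemma cmod_diff_sq_le: "(cmod (z - w))\<^sup>2 \<le> 2 * (cmod z)\<^sup>2 + 2 * (cmod w)\<^sup>2"
proof -
  have "(cmod (z - w))\<^sup>2 \<le> (cmod z + cmod w)\<^sup>2"
    by (intro power_mono norm_triangle_ineq4) simp
  also have "\<dots> \<le> 2 * (cmod z)\<^sup>2 + 2 * (cmod w)\<^sup>2"
    using zero_le_power2[of "cmod z - cmod w"] unfolding power2_diff power2_sum by linarith
  finally show ?thesis .
qed

lemma
  assumes f: "l2fun f" and g: "l2fun g"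
  shows l2fun_diff: "l2fun (\<lambda>x. f x - g x)"
    and l2_normsq_diff_le: "l2_normsq (\<lambda>x. f x - g x) \<le> 2 * l2_normsq f + 2 * l2_normsq g"
proof -
  have [measurable]: "f \<in> borel_measurable borel" "g \<in> borel_measurable borel"
    using f g by (auto simp: l2fun_def)
  have int: "integrable lborel (\<lambda>x. 2 * (cmod (f x))\<^sup>2 + 2 * (cmod (g x))\<^sup>2)"
    using f g by (auto simp: l2fun_def)
  then have int': "integrable lborel (\<lambda>x. (cmod (f x - g x))\<^sup>2)"
    by (rule Bochner_Integration.integrable_bound) (auto intro!: AE_I2 cmod_diff_sq_le)
  then show "l2fun (\<lambda>x. f x - g x)"
    by (simp add: l2fun_def)
  have "l2_normsq (\<lambda>x. f x - g x) \<le> (\<integral>x. 2 * (cmod (f x))\<^sup>2 + 2 * (cmod (g x))\<^sup>2 \<partial>lborel)"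
    unfolding l2_normsq_def by (rule integral_mono[OF int' int]) (rule cmod_diff_sq_le)
  then show "l2_normsq (\<lambda>x. f x - g x) \<le> 2 * l2_normsq f + 2 * l2_normsq g"
    using f g by (simp add: l2fun_def l2_normsq_def)
qed

lemma l2fun_zero: "l2fun (\<lambda>x. 0)"
  by (simp add: l2fun_def)

lemma l2fun_add: "l2fun f \<Longrightarrow> l2fun g \<Longrightarrow> l2fun (\<lambda>x. f x + g x)"
  using l2fun_diff[of f "\<lambda>x. - 1 * g x"] l2fun_cmult[of g "-1"] by simp

lemma l2fun_sum: "(\<And>l. l \<in> S \<Longrightarrow> l2fun (f l)) \<Longrightarrow> l2fun (\<lambda>x. \<Sum>l\<in>S. f l x)"
  by (induction S rule: infinite_finite_induct) (simp_all add: l2fun_zero l2fun_add)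

lemma l2fun_affine:
  assumes f: "l2fun f" and c: "c \<noteq> 0"
  shows "l2fun (\<lambda>x. f (t + c *\<^sub>R x))"
  using integrable_lborel_affine[OF _ c, of "\<lambda>x. (cmod (f x))\<^sup>2" t] f by (auto simp: l2fun_def)

text \<open>Cauchy-Schwarz in bilinear form, without conjugation, because the Weyl form pairs the
  symbol with W without a conjugate.\<close>

lemma
  assumes f: "l2fun f" and g: "l2fun g"
  shows l2fun_integrable_mult: "integrable lborel (\<lambda>x. f x * g x)"
    and cmod_integral_mult_sq_le: "(cmod (\<integral>x. f x * g x \<partial>lborel))\<^sup>2 \<le> l2_normsq f * l2_normsq g"
proof -
  have [measurable]: "f \<in> borel_measurable borel" "g \<in> borel_measurable borel"
    using f g by (auto simp: l2fun_def)
  have "integrable lborel (\<lambda>x. (cmod (f x))\<^sup>2 + (cmod (g x))\<^sup>2)"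
    using f g by (auto simp: l2fun_def)
  then show int: "integrable lborel (\<lambda>x. f x * g x)"
  proof (rule Bochner_Integration.integrable_bound)
    show "AE x in lborel. cmod (f x * g x) \<le> norm ((cmod (f x))\<^sup>2 + (cmod (g x))\<^sup>2)"
    proof (rule AE_I2)
      fix x
      have "2 * (cmod (f x) * cmod (g x)) \<le> (cmod (f x))\<^sup>2 + (cmod (g x))\<^sup>2"
        using zero_le_power2[of "cmod (f x) - cmod (g x)"] by (simp add: power2_diff)
      moreover have "cmod (f x) * cmod (g x) \<ge> 0"
        by simp
      ultimately show "cmod (f x * g x) \<le> norm ((cmod (f x))\<^sup>2 + (cmod (g x))\<^sup>2)"
        unfolding norm_mult real_norm_def by linarith
    qed
  qed simp
  have "ennreal ((cmod (\<integral>x. f x * g x \<partial>lborel))\<^sup>2) = (ennreal (cmod (\<integral>x. f x * g x \<partial>lborel)))\<^sup>2"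
    by (simp add: ennreal_power)
  also have "\<dots> \<le> (\<integral>\<^sup>+x. ennreal (cmod (f x * g x)) \<partial>lborel)\<^sup>2"
    by (intro power_mono integral_norm_bound_ennreal[OF int]) simp
  also have "\<dots> = (\<integral>\<^sup>+x. ennreal (cmod (f x)) * ennreal (cmod (g x)) \<partial>lborel)\<^sup>2"
    by (simp add: norm_mult ennreal_mult)
  also have "\<dots> \<le> (\<integral>\<^sup>+x. (ennreal (cmod (f x)))\<^sup>2 \<partial>lborel) * (\<integral>\<^sup>+x. (ennreal (cmod (g x)))\<^sup>2 \<partial>lborel)"
    by (rule Cauchy_Schwarz_nn_integral) measurable
  also have "\<dots> = ennreal (l2_normsq f * l2_normsq g)"
    by (simp add: ennreal_power nn_integral_l2_normsq[OF f] nn_integral_l2_normsq[OF g] l2_normsq_nonneg ennreal_mult)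
  finally show "(cmod (\<integral>x. f x * g x \<partial>lborel))\<^sup>2 \<le> l2_normsq f * l2_normsq g"
    by (simp add: l2_normsq_nonneg)
qed

lemma l2_inner_self: "l2_inner f f = complex_of_real (l2_normsq f)"
  unfolding l2_inner_def l2_normsq_def integral_complex_of_real[symmetric] complex_norm_square ..

lemma l2_inner_commute: "l2_inner g f = cnj (l2_inner f g)"
  unfolding l2_inner_def by (simp add: Bochner_Integration.integral_cnj[symmetric] mult.commute del: Bochner_Integration.integral_cnj)

lemma l2_inner_diff_left:
  assumes "l2fun f" "l2fun g" "l2fun h"
  shows "l2_inner (\<lambda>x. f x - g x) h = l2_inner f h - l2_inner g h"
  unfolding l2_inner_def left_diff_distrib
  by (rule Bochner_Integration.integral_diff) (use assms in \<open>auto intro!: l2fun_integrable_mult l2fun_cnj\<close>)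

lemma l2_inner_sum_left:
  assumes "\<And>l. l \<in> S \<Longrightarrow> l2fun (f l)" and "l2fun h"
  shows "l2_inner (\<lambda>x. \<Sum>l\<in>S. c l * f l x) h = (\<Sum>l\<in>S. c l * l2_inner (f l) h)"
proof -
  have "l2_inner (\<lambda>x. \<Sum>l\<in>S. c l * f l x) h = (\<integral>x. (\<Sum>l\<in>S. c l * (f l x * cnj (h x))) \<partial>lborel)"
    unfolding l2_inner_def by (simp add: sum_distrib_right mult.assoc)
  also have "\<dots> = (\<Sum>l\<in>S. \<integral>x. c l * (f l x * cnj (h x)) \<partial>lborel)"
    using assms by (intro Bochner_Integration.integral_sum integrable_mult_right l2fun_integrable_mult l2fun_cnj)
  finally show ?thesis
    by (simp add: l2_inner_def)
qed

text \<open>A step of real length t from g along w changes the squared norm by a parabola in t. When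
  \<open>l2_normsq w\<close> is at most B times Re (g | w), the length t = 1 / B lowers it by at
  least Re (g | w) / B.\<close>

lemma l2_normsq_diff_scaled:
  assumes g: "l2fun g" and w: "l2fun w"
  shows "l2_normsq (\<lambda>x. g x - complex_of_real t * w x)
    = l2_normsq g - 2 * t * Re (l2_inner g w) + t\<^sup>2 * l2_normsq w"
proof -
  let ?tw = "\<lambda>x. complex_of_real t * w x"
  have tw: "l2fun ?tw"
    by (rule l2fun_cmult[OF w])
  have scale: "l2_inner ?tw h = complex_of_real t * l2_inner w h" for h
    unfolding l2_inner_def by (simp add: mult.assoc)
  have d: "l2fun (\<lambda>x. g x - ?tw x)"
    by (rule l2fun_diff[OF g tw])
  have "complex_of_real (l2_normsq (\<lambda>x. g x - ?tw x))
      = l2_inner g (\<lambda>x. g x - ?tw x) - complex_of_real t * l2_inner w (\<lambda>x. g x - ?tw x)"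
    unfolding l2_inner_self[symmetric] l2_inner_diff_left[OF g tw d] scale ..
  also have "l2_inner g (\<lambda>x. g x - ?tw x) = cnj (l2_inner g g - complex_of_real t * l2_inner w g)"
    unfolding l2_inner_commute[of g "\<lambda>x. g x - ?tw x"] l2_inner_diff_left[OF g tw g] scale ..
  also have "l2_inner w (\<lambda>x. g x - ?tw x) = cnj (l2_inner g w - complex_of_real t * l2_inner w w)"
    unfolding l2_inner_commute[of w "\<lambda>x. g x - ?tw x"] l2_inner_diff_left[OF g tw w] scale ..
  finally have "complex_of_real (l2_normsq (\<lambda>x. g x - ?tw x))
      = cnj (l2_inner g g - complex_of_real t * l2_inner w g)
        - complex_of_real t * cnj (l2_inner g w - complex_of_real t * l2_inner w w)" .
  from arg_cong[where f = Re, OF this] show ?thesis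
    by (simp add: l2_inner_self l2_inner_commute[of w g] power2_eq_square algebra_simps)
qed

text \<open>Completeness of \<open>L\<^sup>2\<close> is not needed: if \<open>g = f - v\<close> with \<open>v\<close> in the span is within \<open>\<epsilon>\<close> of the minimal
  squared distance, then moving \<open>g\<close> by \<open>1 / B\<close> times a partial sum of its frame expansion can gain at most \<open>\<epsilon>\<close>,
  so the frame coefficients of \<open>g\<close>, and by the lower frame bound \<open>g\<close> itself, are small.\<close>

lemma frame_span_dense:
  fixes e :: "'i \<Rightarrow> 'a::euclidean_space \<Rightarrow> complex"
  assumes e: "\<And>l. l \<in> \<Lambda> \<Longrightarrow> l2fun (e l)"
    and A: "0 < A" and B: "0 < B"
    and summable: "\<And>f. l2fun f \<Longrightarrow> (\<lambda>l. (cmod (l2_inner f (e l)))\<^sup>2) summable_on \<Lambda>"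
    and lower: "\<And>f. l2fun f \<Longrightarrow> A * l2_normsq f \<le> (\<Sum>\<^sub>\<infinity>l\<in>\<Lambda>. (cmod (l2_inner f (e l)))\<^sup>2)"
    and upper: "\<And>f. l2fun f \<Longrightarrow> (\<Sum>\<^sub>\<infinity>l\<in>\<Lambda>. (cmod (l2_inner f (e l)))\<^sup>2) \<le> B * l2_normsq f"
    and f: "l2fun f" and \<delta>: "\<delta> > 0"
  obtains F \<zeta> where "finite F" "F \<subseteq> \<Lambda>" "l2_normsq (\<lambda>x. f x - (\<Sum>l\<in>F. \<zeta> l * e l x)) < \<delta>"
proof -
  define S where "S = {l2_normsq (\<lambda>x. f x - (\<Sum>l\<in>F. \<zeta> l * e l x)) | F \<zeta>. finite F \<and> F \<subseteq> \<Lambda>}"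
  \<comment> \<open>Chosen so that the final estimate A |g|^2 \<le> \<epsilon> B reads |g|^2 \<le>
    \<delta> / 2, which leaves the strict inequality.\<close>
  define \<epsilon> where "\<epsilon> = \<delta> * A / (2 * B)"
  have \<epsilon>: "\<epsilon> > 0"
    using A B \<delta> by (simp add: \<epsilon>_def)
  have "S \<noteq> {}"
    unfolding S_def by blast
  moreover have bdd: "bdd_below S"
    unfolding S_def by (rule bdd_belowI[of _ 0]) (auto simp: l2_normsq_nonneg)
  moreover have "Inf S < Inf S + \<epsilon>"
    using \<epsilon> by simp
  ultimately obtain F \<zeta> where F: "finite F" "F \<subseteq> \<Lambda>"
    and near: "l2_normsq (\<lambda>x. f x - (\<Sum>l\<in>F. \<zeta> l * e l x)) < Inf S + \<epsilon>"
    using cInf_lessD[of S "Inf S + \<epsilon>"] unfolding S_def by blast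
  define g where "g = (\<lambda>x. f x - (\<Sum>l\<in>F. \<zeta> l * e l x))"
  have g: "l2fun g"
    unfolding g_def using F by (intro l2fun_diff f l2fun_sum l2fun_cmult e) auto
  define c where "c l = l2_inner g (e l)" for l
  \<comment> \<open>The bound is the same for every finite \<open>G\<close>, so it passes to the
    infinite sum in the lower frame inequality.\<close>
  have coeff: "(\<Sum>l\<in>G. (cmod (c l))\<^sup>2) \<le> \<epsilon> * B" if G: "finite G" "G \<subseteq> \<Lambda>" for G
  proof -
    define w where "w = (\<lambda>x. \<Sum>l\<in>G. c l * e l x)"
    define s where "s = (\<Sum>l\<in>G. (cmod (c l))\<^sup>2)"
    have eG: "l \<in> G \<Longrightarrow> l2fun (e l)" for l
      using e G by blast
    have w: "l2fun w"
      unfolding w_def by (intro l2fun_sum l2fun_cmult eG)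
    have "l2_inner w g = (\<Sum>l\<in>G. c l * l2_inner (e l) g)"
      unfolding w_def by (rule l2_inner_sum_left[OF eG g])
    also have "\<dots> = complex_of_real s"
      unfolding s_def of_real_sum complex_norm_square c_def by (simp add: l2_inner_commute[of "e _" g])
    finally have gw: "Re (l2_inner g w) = s"
      by (simp add: l2_inner_commute[of g w])
    have "complex_of_real (l2_normsq w) = (\<Sum>l\<in>G. c l * l2_inner (e l) w)"
      unfolding l2_inner_self[symmetric] by (subst w_def) (rule l2_inner_sum_left[OF eG w])
    then have "l2_normsq w = cmod (\<Sum>l\<in>G. c l * l2_inner (e l) w)"
      by (metis abs_of_nonneg l2_normsq_nonneg norm_of_real)
    also have "\<dots> \<le> (\<Sum>l\<in>G. cmod (c l) * cmod (l2_inner w (e l)))"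
      by (rule sum_norm_le) (simp add: norm_mult l2_inner_commute[of "e _" w])
    \<comment> \<open>The weights B and 1 / B are balanced so that the upper frame bound, applied to
      \<open>w\<close>, turns the second sum into at most half of \<open>l2_normsq w\<close>.
      Absorbing this half on the left gives the bound B * s: synthesis has the same norm bound as
      analysis.\<close>
    also have "\<dots> \<le> (\<Sum>l\<in>G. B / 2 * (cmod (c l))\<^sup>2 + 1 / (2 * B) * (cmod (l2_inner w (e l)))\<^sup>2)"
    proof (rule sum_mono)
      fix l
      let ?x = "cmod (c l)" and ?y = "cmod (l2_inner w (e l))"
      have "0 \<le> (B * ?x - ?y)\<^sup>2 / (2 * B)"
        using B by simp
      also have "\<dots> = B / 2 * ?x\<^sup>2 + 1 / (2 * B) * ?y\<^sup>2 - ?x * ?y"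
        using B by (simp add: power2_eq_square field_simps)
      finally show "?x * ?y \<le> B / 2 * ?x\<^sup>2 + 1 / (2 * B) * ?y\<^sup>2"
        by simp
    qed
    also have "\<dots> = B / 2 * s + 1 / (2 * B) * (\<Sum>l\<in>G. (cmod (l2_inner w (e l)))\<^sup>2)"
      by (simp add: s_def sum.distrib sum_distrib_left)
    also have "\<dots> \<le> B / 2 * s + 1 / (2 * B) * (B * l2_normsq w)"
    proof -
      have "(\<Sum>l\<in>G. (cmod (l2_inner w (e l)))\<^sup>2) \<le> B * l2_normsq w"
        using finite_sum_le_infsum[OF summable[OF w] G] upper[OF w] by simp
      then show ?thesis
        using B by (intro add_left_mono mult_left_mono) auto
    qed
    finally have ww: "l2_normsq w \<le> B * s"
      using B by simp
    \<comment> \<open>Coefficients of the improved approximant v + w / B. \<open>F\<close> and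
      \<open>G\<close> may overlap, hence the sum of two coefficient families, each extended by
      zero.\<close>
    let ?\<xi> = "\<lambda>l. (if l \<in> F then \<zeta> l else 0) + (if l \<in> G then complex_of_real (1 / B) * c l else 0)"
    have "(\<lambda>x. g x - complex_of_real (1 / B) * w x) = (\<lambda>x. f x - (\<Sum>l\<in>F \<union> G. ?\<xi> l * e l x))"
    proof
      fix x
      have "(\<Sum>l\<in>F \<union> G. (if l \<in> F then \<zeta> l else 0) * e l x) = (\<Sum>l\<in>F. \<zeta> l * e l x)"
        using F G by (intro sum.mono_neutral_cong_right) auto
      moreover have "(\<Sum>l\<in>F \<union> G. (if l \<in> G then complex_of_real (1 / B) * c l else 0) * e l x)
          = complex_of_real (1 / B) * w x"
        unfolding w_def sum_distrib_left using F G by (intro sum.mono_neutral_cong_right) auto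
      ultimately show "g x - complex_of_real (1 / B) * w x = f x - (\<Sum>l\<in>F \<union> G. ?\<xi> l * e l x)"
        by (simp add: g_def distrib_right sum.distrib)
    qed
    then have "l2_normsq (\<lambda>x. g x - complex_of_real (1 / B) * w x) \<in> S"
      unfolding S_def using F G by (auto intro!: exI[of _ "F \<union> G"] exI[of _ ?\<xi>])
    then have "Inf S \<le> l2_normsq (\<lambda>x. g x - complex_of_real (1 / B) * w x)"
      using bdd by (rule cInf_lower)
    also have "\<dots> = l2_normsq g - 2 * (1 / B) * s + (1 / B)\<^sup>2 * l2_normsq w"
      unfolding l2_normsq_diff_scaled[OF g w] gw ..
    also have "\<dots> \<le> l2_normsq g - 2 * (1 / B) * s + (1 / B)\<^sup>2 * (B * s)"
      using ww by (intro add_left_mono mult_left_mono) auto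
    also have "\<dots> = l2_normsq g - s / B"
      using B by (simp add: power2_eq_square field_simps)
    finally have "s / B < \<epsilon>"
      using near unfolding g_def by linarith
    then show ?thesis
      using B by (simp add: s_def[symmetric] field_simps)
  qed
  have "A * l2_normsq g \<le> \<epsilon> * B"
    using lower[OF g] infsum_le_finite_sums[OF summable[OF g], of "\<epsilon> * B"] coeff
    unfolding c_def by fastforce
  also have "\<dots> = A * (\<delta> / 2)"
    using B by (simp add: \<epsilon>_def)
  finally have "l2_normsq g < \<delta>"
    using A \<delta> by simp
  then show thesis
    using that F unfolding g_def by blast
qed

subsection \<open>The cross-Wigner transform and the Weyl form\<close>

lemma wigner_measurable:
  fixes f g :: "'a::euclidean_space \<Rightarrow> complex"
  assumes [measurable]: "f \<in> borel_measurable borel" "g \<in> borel_measurable borel"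
  shows "(\<lambda>z. wigner \<eta> f g (fst z) (snd z)) \<in> borel_measurable (borel \<Otimes>\<^sub>M borel)"
  unfolding wigner_def by measurable

text \<open>For each fixed X and P both factors are square-integrable in Y. The integral hence
  converges at every point, and linearity of W holds pointwise rather than almost
  everywhere.\<close>

lemma wigner_integrable:
  fixes f g :: "'a::euclidean_space \<Rightarrow> complex"
  assumes f: "l2fun f" and g: "l2fun g"
  shows "integrable lborel (\<lambda>Y. exp (- \<i> * complex_of_real ((P \<bullet> Y) / \<eta>)) *
        f (X + (1/2) *\<^sub>R Y) * cnj (g (X - (1/2) *\<^sub>R Y)))"
proof (rule l2fun_integrable_mult)
  show "l2fun (\<lambda>Y. exp (- \<i> * complex_of_real ((P \<bullet> Y) / \<eta>)) * f (X + (1/2) *\<^sub>R Y))"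
    by (intro l2fun_unimodular l2fun_affine[OF f]) (simp_all add: norm_exp_i_times)
  show "l2fun (\<lambda>Y. cnj (g (X - (1/2) *\<^sub>R Y)))"
    using l2fun_affine[OF g, of "-1/2" X] by (simp add: l2fun_cnj)
qed

text \<open>The map (X, Y) to (X + Y/2, X - Y/2) preserves volume. It is carried out as two
  substitutions in one block of variables each, with Tonelli between them; their factors 2^d and
  2^(-d) cancel.\<close>

lemma nn_integral_shear:
  fixes u v :: "'a::euclidean_space \<Rightarrow> ennreal"
  assumes [measurable]: "u \<in> borel_measurable borel" "v \<in> borel_measurable borel"
  shows "(\<integral>\<^sup>+X. \<integral>\<^sup>+Y. u (X + (1/2) *\<^sub>R Y) * v (X - (1/2) *\<^sub>R Y) \<partial>lborel \<partial>lborel)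
    = (\<integral>\<^sup>+x. u x \<partial>lborel) * (\<integral>\<^sup>+x. v x \<partial>lborel)"
proof -
  let ?c = "\<lambda>r::real. ennreal (\<bar>r\<bar> ^ DIM('a))"
  have c: "?c 2 * ?c (1/2) = 1"
    by (simp add: ennreal_mult[symmetric] power_one_over)
  have "(\<integral>\<^sup>+Y. u (X + (1/2) *\<^sub>R Y) * v (X - (1/2) *\<^sub>R Y) \<partial>lborel)
      = ?c 2 * (\<integral>\<^sup>+x. u x * v (2 *\<^sub>R X - x) \<partial>lborel)" for X
  proof -
    let ?I = "\<integral>\<^sup>+Y. u (X + (1/2) *\<^sub>R Y) * v (2 *\<^sub>R X - (X + (1/2) *\<^sub>R Y)) \<partial>lborel"
    have "?I = ?c 2 * (?c (1/2) * ?I)"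
      by (simp only: mult.assoc[symmetric] c mult_1)
    also have "?c (1/2) * ?I = (\<integral>\<^sup>+x. u x * v (2 *\<^sub>R X - x) \<partial>lborel)"
      by (rule nn_integral_lborel_affine[symmetric]) simp_all
    finally show ?thesis
      by (simp add: scaleR_2)
  qed
  then have "(\<integral>\<^sup>+X. \<integral>\<^sup>+Y. u (X + (1/2) *\<^sub>R Y) * v (X - (1/2) *\<^sub>R Y) \<partial>lborel \<partial>lborel)
      = (\<integral>\<^sup>+X. \<integral>\<^sup>+x. ?c 2 * (u x * v (2 *\<^sub>R X - x)) \<partial>lborel \<partial>lborel)"
    by (simp add: nn_integral_cmult)
  also have "\<dots> = (\<integral>\<^sup>+x. \<integral>\<^sup>+X. ?c 2 * (u x * v (2 *\<^sub>R X - x)) \<partial>lborel \<partial>lborel)"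
    by (rule lborel_pair.Fubini'[symmetric]) measurable
  also have "\<dots> = (\<integral>\<^sup>+x. u x * (\<integral>\<^sup>+X. v X \<partial>lborel) \<partial>lborel)"
  proof (rule nn_integral_cong)
    fix x :: 'a
    have "(\<integral>\<^sup>+X. ?c 2 * (u x * v (2 *\<^sub>R X - x)) \<partial>lborel) = u x * (?c 2 * (\<integral>\<^sup>+X. v (2 *\<^sub>R X - x) \<partial>lborel))"
      by (simp add: nn_integral_cmult mult_ac)
    then show "(\<integral>\<^sup>+X. ?c 2 * (u x * v (2 *\<^sub>R X - x)) \<partial>lborel) = u x * (\<integral>\<^sup>+X. v X \<partial>lborel)"
      using nn_integral_lborel_affine[of v 2 "- x"] by simp
  qed
  finally show ?thesis
    by (simp add: nn_integral_multc)
qed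

text \<open>The inequality half of Moyal's identity. For fixed X, the transform is a Fourier
  transform in Y evaluated at P / \<eta>, so Plancherel handles P and the shear handles (X, Y). The
  constant collects (2 pi |\<eta>|)^(-2d) from the squared prefactor, |\<eta>|^d from rescaling P
  and (2 pi)^d from Plancherel.\<close>

lemma
  fixes f g :: "'a::euclidean_space \<Rightarrow> complex"
  assumes \<eta>: "\<eta> \<noteq> 0" and f: "l2fun f" and g: "l2fun g"
  shows l2fun_wigner: "l2fun (\<lambda>z. wigner \<eta> f g (fst z) (snd z))"
    and l2_normsq_wigner_le: "l2_normsq (\<lambda>z. wigner \<eta> f g (fst z) (snd z))
      \<le> 1 / (2 * pi * \<bar>\<eta>\<bar>) ^ DIM('a) * (l2_normsq f * l2_normsq g)"
proof -
  note [measurable] = l2fun_borel_measurable[OF f] l2fun_borel_measurable[OF g]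
  let ?D = "(2 * pi * \<bar>\<eta>\<bar>) ^ DIM('a)"
  have D: "?D > 0"
    using \<eta> by simp
  define h where "h X Y = f (X + (1/2) *\<^sub>R Y) * cnj (g (X - (1/2) *\<^sub>R Y))" for X Y
  define F where "F X p = (\<integral>y. exp (- \<i> * complex_of_real (p \<bullet> y)) * h X y \<partial>lborel)" for X p
  have [measurable]: "case_prod h \<in> borel_measurable (borel \<Otimes>\<^sub>M borel)"
    unfolding h_def by measurable
  have [measurable]: "F X \<in> borel_measurable borel" for X
    unfolding F_def by measurable
  have int_h: "integrable lborel (h X)" for X
    using wigner_integrable[OF f g, of 0 \<eta> X] by (simp add: h_def[abs_def])
  have W: "(cmod (wigner \<eta> f g X P))\<^sup>2 = 1 / ?D\<^sup>2 * (cmod (F X (inverse \<eta> *\<^sub>R P)))\<^sup>2" for X P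
  proof -
    have scale: "(P \<bullet> Y) / \<eta> = (inverse \<eta> *\<^sub>R P) \<bullet> Y" for Y
      by (simp add: divide_inverse mult.commute)
    have "wigner \<eta> f g X P = 1 / complex_of_real ((2 * pi * \<eta>) ^ DIM('a)) * F X (inverse \<eta> *\<^sub>R P)"
      unfolding wigner_def F_def h_def scale mult.assoc ..
    moreover have "cmod (1 / complex_of_real ((2 * pi * \<eta>) ^ DIM('a))) = 1 / ?D"
      by (simp add: norm_divide norm_power norm_mult)
    ultimately show ?thesis
      by (simp only: norm_mult power_mult_distrib power_divide power_one)
  qed
  have inner: "(\<integral>\<^sup>+P. ennreal ((cmod (wigner \<eta> f g X P))\<^sup>2) \<partial>lborel)
      \<le> ennreal (1 / ?D) * (\<integral>\<^sup>+y. ennreal ((cmod (h X y))\<^sup>2) \<partial>lborel)" for X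
  proof -
    have assoc: "ennreal a * (ennreal b * (ennreal c * I)) = ennreal (a * (b * c)) * I"
      if "a \<ge> 0" "b \<ge> 0" "c \<ge> 0" for a b c I
      using that by (simp add: ennreal_mult mult.assoc)
    have "(\<integral>\<^sup>+P. ennreal ((cmod (wigner \<eta> f g X P))\<^sup>2) \<partial>lborel)
        = ennreal (1 / ?D\<^sup>2) * (\<integral>\<^sup>+P. ennreal ((cmod (F X (inverse \<eta> *\<^sub>R P)))\<^sup>2) \<partial>lborel)"
      unfolding W by (subst nn_integral_cmult[symmetric]) (auto simp: ennreal_mult'[symmetric])
    also have "(\<integral>\<^sup>+P. ennreal ((cmod (F X (inverse \<eta> *\<^sub>R P)))\<^sup>2) \<partial>lborel)
        = ennreal (\<bar>\<eta>\<bar> ^ DIM('a)) * (\<integral>\<^sup>+p. ennreal ((cmod (F X p))\<^sup>2) \<partial>lborel)"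
      using nn_integral_lborel_affine[of "\<lambda>P. ennreal ((cmod (F X (inverse \<eta> *\<^sub>R P)))\<^sup>2)" \<eta> 0] \<eta> by simp
    also have "ennreal (1 / ?D\<^sup>2) * (ennreal (\<bar>\<eta>\<bar> ^ DIM('a)) * (\<integral>\<^sup>+p. ennreal ((cmod (F X p))\<^sup>2) \<partial>lborel))
        \<le> ennreal (1 / ?D\<^sup>2) * (ennreal (\<bar>\<eta>\<bar> ^ DIM('a)) *
            (ennreal ((2 * pi) ^ DIM('a)) * (\<integral>\<^sup>+y. ennreal ((cmod (h X y))\<^sup>2) \<partial>lborel)))"
      using plancherel_le[OF int_h[of X]] unfolding F_def by (intro mult_left_mono) auto
    also have "\<dots> = ennreal (1 / ?D\<^sup>2 * (\<bar>\<eta>\<bar> ^ DIM('a) * (2 * pi) ^ DIM('a))) * (\<integral>\<^sup>+y. ennreal ((cmod (h X y))\<^sup>2) \<partial>lborel)"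
      by (rule assoc) simp_all
    also have "1 / ?D\<^sup>2 * (\<bar>\<eta>\<bar> ^ DIM('a) * (2 * pi) ^ DIM('a)) = 1 / ?D"
      using D by (simp add: power_mult_distrib power2_eq_square field_simps)
    finally show ?thesis .
  qed
  have [measurable]: "(\<lambda>z. wigner \<eta> f g (fst z) (snd z)) \<in> borel_measurable (borel \<Otimes>\<^sub>M borel)"
    by (rule wigner_measurable) measurable
  have "(\<integral>\<^sup>+z. ennreal ((cmod (wigner \<eta> f g (fst z) (snd z)))\<^sup>2) \<partial>lborel)
      = (\<integral>\<^sup>+X. \<integral>\<^sup>+P. ennreal ((cmod (wigner \<eta> f g X P))\<^sup>2) \<partial>lborel \<partial>lborel)"
    by (subst nn_integral_lborel_fst) auto
  also have "\<dots> \<le> (\<integral>\<^sup>+X. ennreal (1 / ?D) * (\<integral>\<^sup>+y. ennreal ((cmod (h X y))\<^sup>2) \<partial>lborel) \<partial>lborel)"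
    by (intro nn_integral_mono inner)
  also have "\<dots> = ennreal (1 / ?D) * (\<integral>\<^sup>+X. \<integral>\<^sup>+y. ennreal ((cmod (h X y))\<^sup>2) \<partial>lborel \<partial>lborel)"
    by (rule nn_integral_cmult) measurable
  also have "(\<integral>\<^sup>+X. \<integral>\<^sup>+y. ennreal ((cmod (h X y))\<^sup>2) \<partial>lborel \<partial>lborel)
      = (\<integral>\<^sup>+x. ennreal ((cmod (f x))\<^sup>2) \<partial>lborel) * (\<integral>\<^sup>+x. ennreal ((cmod (g x))\<^sup>2) \<partial>lborel)"
    by (subst nn_integral_shear[symmetric]) (auto simp: h_def norm_mult power_mult_distrib ennreal_mult)
  also have "ennreal (1 / ?D) * \<dots> = ennreal (1 / ?D * (l2_normsq f * l2_normsq g))"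
  proof -
    have assoc: "ennreal a * (ennreal b * ennreal c) = ennreal (a * (b * c))"
      if "a \<ge> 0" "b \<ge> 0" "c \<ge> 0" for a b c
      using that by (simp add: ennreal_mult)
    show ?thesis
      unfolding nn_integral_l2_normsq[OF f] nn_integral_l2_normsq[OF g]
      by (rule assoc) (simp_all add: l2_normsq_nonneg)
  qed
  finally have le: "(\<integral>\<^sup>+z. ennreal ((cmod (wigner \<eta> f g (fst z) (snd z)))\<^sup>2) \<partial>lborel)
      \<le> ennreal (1 / ?D * (l2_normsq f * l2_normsq g))" .
  have "(\<lambda>z. wigner \<eta> f g (fst z) (snd z)) \<in> borel_measurable borel"
    unfolding borel_prod[symmetric] by measurable
  moreover have "1 / ?D * (l2_normsq f * l2_normsq g) \<ge> 0"
    using D by (simp add: l2_normsq_nonneg)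
  ultimately show "l2fun (\<lambda>z. wigner \<eta> f g (fst z) (snd z))"
    and "l2_normsq (\<lambda>z. wigner \<eta> f g (fst z) (snd z)) \<le> 1 / ?D * (l2_normsq f * l2_normsq g)"
    using l2funI_bounded[OF _ le] by blast+
qed

text \<open>Polarisation of \<open>weyl_form\<close>: it stands for (Op(a) f | g), linear in
  \<open>f\<close> and antilinear in \<open>g\<close>.\<close>

definition weyl_sesq ::
    "real \<Rightarrow> ('a::euclidean_space \<times> 'a \<Rightarrow> complex) \<Rightarrow> ('a \<Rightarrow> complex) \<Rightarrow> ('a \<Rightarrow> complex) \<Rightarrow> complex" where
  "weyl_sesq \<eta> a f g = (\<integral>z. a z * wigner \<eta> f g (fst z) (snd z) \<partial>lborel)"

lemma weyl_form_eq_sesq: "weyl_form \<eta> a \<psi> = weyl_sesq \<eta> a \<psi> \<psi>"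
  by (simp add: weyl_form_def weyl_sesq_def wig_def)

lemma wigner_sum_left:
  fixes g :: "'a::euclidean_space \<Rightarrow> complex"
  assumes "\<And>l. l \<in> S \<Longrightarrow> l2fun (f l)" and "l2fun g"
  shows "wigner \<eta> (\<lambda>x. \<Sum>l\<in>S. c l * f l x) g X P = (\<Sum>l\<in>S. c l * wigner \<eta> (f l) g X P)"
proof -
  let ?E = "\<lambda>l Y. exp (- \<i> * complex_of_real ((P \<bullet> Y) / \<eta>)) * f l (X + (1/2) *\<^sub>R Y) * cnj (g (X - (1/2) *\<^sub>R Y))"
  have "(\<integral>Y. exp (- \<i> * complex_of_real ((P \<bullet> Y) / \<eta>)) * (\<Sum>l\<in>S. c l * f l (X + (1/2) *\<^sub>R Y))
        * cnj (g (X - (1/2) *\<^sub>R Y)) \<partial>lborel) = (\<integral>Y. (\<Sum>l\<in>S. c l * ?E l Y) \<partial>lborel)"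
    by (simp only: sum_distrib_left sum_distrib_right mult_ac)
  also have "\<dots> = (\<Sum>l\<in>S. \<integral>Y. c l * ?E l Y \<partial>lborel)"
    using assms by (intro Bochner_Integration.integral_sum integrable_mult_right wigner_integrable)
  also have "\<dots> = (\<Sum>l\<in>S. c l * (\<integral>Y. ?E l Y \<partial>lborel))"
    by (simp only: integral_mult_right_zero)
  finally show ?thesis
    unfolding wigner_def by (simp only: sum_distrib_left mult.left_commute)
qed

text \<open>Conjugation followed by the substitution of -Y for Y exchanges the two functions. Two
  consequences are used: antilinearity in the second argument follows from linearity in the first,
  and W \<phi> is real-valued.\<close>

lemma cnj_wigner:
  fixes f g :: "'a::euclidean_space \<Rightarrow> complex"
  assumes [measurable]: "f \<in> borel_measurable borel" "g \<in> borel_measurable borel"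
  shows "cnj (wigner \<eta> f g X P) = wigner \<eta> g f X P"
proof -
  let ?E = "\<lambda>Y. exp (- \<i> * complex_of_real ((P \<bullet> Y) / \<eta>)) * g (X + (1/2) *\<^sub>R Y) * cnj (f (X - (1/2) *\<^sub>R Y))"
  have "integral\<^sup>L lborel ?E = (\<integral>Y. ?E (- Y) \<partial>lborel)"
    using integral_lborel_affine[of ?E "-1" 0] by simp
  also have "(\<lambda>Y. ?E (- Y)) = (\<lambda>Y. cnj (exp (- \<i> * complex_of_real ((P \<bullet> Y) / \<eta>)) * f (X + (1/2) *\<^sub>R Y) * cnj (g (X - (1/2) *\<^sub>R Y))))"
    by (simp add: exp_cnj mult_ac)
  finally show ?thesis
    unfolding wigner_def Bochner_Integration.integral_cnj by simp
qed

lemma wigner_sum_right: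
  fixes f :: "'a::euclidean_space \<Rightarrow> complex"
  assumes g: "\<And>l. l \<in> S \<Longrightarrow> l2fun (g l)" and f: "l2fun f"
  shows "wigner \<eta> f (\<lambda>x. \<Sum>l\<in>S. c l * g l x) X P = (\<Sum>l\<in>S. cnj (c l) * wigner \<eta> f (g l) X P)"
proof -
  have "l2fun (\<lambda>x. \<Sum>l\<in>S. c l * g l x)"
    by (intro l2fun_sum l2fun_cmult g)
  then have "wigner \<eta> f (\<lambda>x. \<Sum>l\<in>S. c l * g l x) X P = cnj (wigner \<eta> (\<lambda>x. \<Sum>l\<in>S. c l * g l x) f X P)"
    using f by (simp add: cnj_wigner l2fun_borel_measurable)
  also have "\<dots> = (\<Sum>l\<in>S. cnj (c l) * cnj (wigner \<eta> (g l) f X P))"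
    by (simp add: wigner_sum_left[OF g f])
  also have "\<dots> = (\<Sum>l\<in>S. cnj (c l) * wigner \<eta> f (g l) X P)"
    using f g by (intro sum.cong) (simp_all add: cnj_wigner l2fun_borel_measurable)
  finally show ?thesis .
qed

section \<open>Boundedness, sesquilinearity and continuity of the Weyl form\<close>

context
  fixes \<eta> :: real and a :: "'a::euclidean_space \<times> 'a \<Rightarrow> complex"
  assumes \<eta>: "\<eta> \<noteq> 0" and a: "l2fun a"
begin

lemma weyl_sesq_integrable:
  "l2fun f \<Longrightarrow> l2fun g \<Longrightarrow> integrable lborel (\<lambda>z. a z * wigner \<eta> f g (fst z) (snd z))"
  by (intro l2fun_integrable_mult a l2fun_wigner \<eta>)

lemma weyl_sesq_bound:
  assumes f: "l2fun f" and g: "l2fun g"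
  shows "cmod (weyl_sesq \<eta> a f g)
    \<le> sqrt (l2_normsq a / (2 * pi * \<bar>\<eta>\<bar>) ^ DIM('a) * (l2_normsq f * l2_normsq g))"
proof (rule real_le_rsqrt)
  have "(cmod (weyl_sesq \<eta> a f g))\<^sup>2 \<le> l2_normsq a * l2_normsq (\<lambda>z. wigner \<eta> f g (fst z) (snd z))"
    unfolding weyl_sesq_def by (intro cmod_integral_mult_sq_le a l2fun_wigner \<eta> f g)
  also have "\<dots> \<le> l2_normsq a * (1 / (2 * pi * \<bar>\<eta>\<bar>) ^ DIM('a) * (l2_normsq f * l2_normsq g))"
    by (intro mult_left_mono l2_normsq_wigner_le \<eta> f g l2_normsq_nonneg)
  finally show "(cmod (weyl_sesq \<eta> a f g))\<^sup>2 \<le> l2_normsq a / (2 * pi * \<bar>\<eta>\<bar>) ^ DIM('a) * (l2_normsq f * l2_normsq g)"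
    by simp
qed

lemma weyl_sesq_sum_left:
  assumes "\<And>l. l \<in> S \<Longrightarrow> l2fun (f l)" and "l2fun g"
  shows "weyl_sesq \<eta> a (\<lambda>x. \<Sum>l\<in>S. c l * f l x) g = (\<Sum>l\<in>S. c l * weyl_sesq \<eta> a (f l) g)"
proof -
  have "weyl_sesq \<eta> a (\<lambda>x. \<Sum>l\<in>S. c l * f l x) g
      = (\<integral>z. (\<Sum>l\<in>S. c l * (a z * wigner \<eta> (f l) g (fst z) (snd z))) \<partial>lborel)"
    unfolding weyl_sesq_def by (simp only: wigner_sum_left[OF assms] sum_distrib_left mult.left_commute)
  also have "\<dots> = (\<Sum>l\<in>S. \<integral>z. c l * (a z * wigner \<eta> (f l) g (fst z) (snd z)) \<partial>lborel)"
    using assms by (intro Bochner_Integration.integral_sum integrable_mult_right weyl_sesq_integrable)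
  finally show ?thesis
    by (simp only: integral_mult_right_zero weyl_sesq_def)
qed

lemma weyl_sesq_sum_right:
  assumes "\<And>l. l \<in> S \<Longrightarrow> l2fun (g l)" and "l2fun f"
  shows "weyl_sesq \<eta> a f (\<lambda>x. \<Sum>l\<in>S. c l * g l x) = (\<Sum>l\<in>S. cnj (c l) * weyl_sesq \<eta> a f (g l))"
proof -
  have "weyl_sesq \<eta> a f (\<lambda>x. \<Sum>l\<in>S. c l * g l x)
      = (\<integral>z. (\<Sum>l\<in>S. cnj (c l) * (a z * wigner \<eta> f (g l) (fst z) (snd z))) \<partial>lborel)"
    unfolding weyl_sesq_def by (simp only: wigner_sum_right[OF assms] sum_distrib_left mult.left_commute)
  also have "\<dots> = (\<Sum>l\<in>S. \<integral>z. cnj (c l) * (a z * wigner \<eta> f (g l) (fst z) (snd z)) \<partial>lborel)"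
    using assms by (intro Bochner_Integration.integral_sum integrable_mult_right weyl_sesq_integrable)
  finally show ?thesis
    by (simp only: integral_mult_right_zero weyl_sesq_def)
qed

lemma weyl_sesq_diff_left:
  assumes "l2fun f" "l2fun f'" "l2fun g"
  shows "weyl_sesq \<eta> a (\<lambda>x. f x - f' x) g = weyl_sesq \<eta> a f g - weyl_sesq \<eta> a f' g"
  \<comment> \<open>A difference is treated as a sum indexed by the two booleans, with coefficients
    1 and -1.\<close>
  using weyl_sesq_sum_left[of "{True, False}" "\<lambda>b. if b then f else f'" g "\<lambda>b. if b then 1 else - 1"] assms
  by simp

lemma weyl_sesq_diff_right:
  assumes "l2fun f" "l2fun g" "l2fun g'"
  shows "weyl_sesq \<eta> a f (\<lambda>x. g x - g' x) = weyl_sesq \<eta> a f g - weyl_sesq \<eta> a f g'"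
  using weyl_sesq_sum_right[of "{True, False}" "\<lambda>b. if b then g else g'" f "\<lambda>b. if b then 1 else - 1"] assms
  by simp

lemma tendsto_weyl_sesq:
  assumes \<psi>: "l2fun \<psi>" and v: "\<And>k. l2fun (v k)"
    and lim: "(\<lambda>k. l2_normsq (\<lambda>x. \<psi> x - v k x)) \<longlonglongrightarrow> 0"
  shows "(\<lambda>k. weyl_sesq \<eta> a (v k) (v k)) \<longlonglongrightarrow> weyl_sesq \<eta> a \<psi> \<psi>"
proof -
  define K where "K = l2_normsq a / (2 * pi * \<bar>\<eta>\<bar>) ^ DIM('a)"
  define d where "d k = l2_normsq (\<lambda>x. \<psi> x - v k x)" for k
  \<comment> \<open>With b the form and v = \<open>v k\<close>, the two roots bound the terms of
    b(\<psi>,\<psi>) - b(v,v) = b(\<psi> - v, \<psi>) + b(v, \<psi> - v). The norm of v is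
    controlled by writing v = \<psi> - (\<psi> - v), which gives the factor 2 |\<psi>|^2 + 2
    d.\<close>
  let ?bound = "\<lambda>k. sqrt (K * (d k * l2_normsq \<psi>)) + sqrt (K * ((2 * l2_normsq \<psi> + 2 * d k) * d k))"
  have K: "K \<ge> 0"
    by (simp add: K_def l2_normsq_nonneg)
  have diff: "l2fun (\<lambda>x. \<psi> x - v k x)" for k
    by (intro l2fun_diff \<psi> v)
  have bound: "cmod (weyl_sesq \<eta> a (v k) (v k) - weyl_sesq \<eta> a \<psi> \<psi>) \<le> ?bound k" for k
  proof -
    have "weyl_sesq \<eta> a \<psi> \<psi> - weyl_sesq \<eta> a (v k) (v k)
        = weyl_sesq \<eta> a (\<lambda>x. \<psi> x - v k x) \<psi> + weyl_sesq \<eta> a (v k) (\<lambda>x. \<psi> x - v k x)"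
      by (simp add: weyl_sesq_diff_left weyl_sesq_diff_right \<psi> v)
    then have "cmod (weyl_sesq \<eta> a (v k) (v k) - weyl_sesq \<eta> a \<psi> \<psi>)
        \<le> cmod (weyl_sesq \<eta> a (\<lambda>x. \<psi> x - v k x) \<psi>) + cmod (weyl_sesq \<eta> a (v k) (\<lambda>x. \<psi> x - v k x))"
      by (metis norm_minus_commute norm_triangle_ineq)
    also have "\<dots> \<le> sqrt (K * (d k * l2_normsq \<psi>)) + sqrt (K * (l2_normsq (v k) * d k))"
      unfolding K_def d_def by (intro add_mono weyl_sesq_bound diff \<psi> v)
    also have "l2_normsq (v k) \<le> 2 * l2_normsq \<psi> + 2 * d k"
      using l2_normsq_diff_le[OF \<psi> diff[of k]] by (simp add: d_def)
    finally show ?thesis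
      using K by (simp add: mult_left_mono mult_right_mono d_def l2_normsq_nonneg)
  qed
  have "?bound \<longlonglongrightarrow> sqrt (K * (0 * l2_normsq \<psi>)) + sqrt (K * ((2 * l2_normsq \<psi> + 2 * 0) * 0))"
    using lim unfolding d_def[symmetric] by (intro tendsto_intros)
  then have "?bound \<longlonglongrightarrow> 0"
    by simp
  then have "(\<lambda>k. weyl_sesq \<eta> a (v k) (v k) - weyl_sesq \<eta> a \<psi> \<psi>) \<longlonglongrightarrow> 0"
    by (rule Lim_null_comparison[OF always_eventually, rotated]) (use bound in blast)
  then show ?thesis
    by (simp only: LIM_zero_iff)
qed

end

subsection \<open>Gabor matrices\<close>

text \<open>Coordinates with respect to a basis are bounded linear functionals, so a norm bound
  leaves finitely many integer values for each coordinate. This guards the sums over balls, since a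
  \<open>sum\<close> over an infinite set would be 0.\<close>

lemma lattice_finite_norm_le:
  fixes L :: "'a::euclidean_space set"
  assumes "lattice L"
  shows "finite {l \<in> L. norm l \<le> r}"
proof -
  obtain B :: "'a set" where B: "independent B"
    and L: "L = range (\<lambda>k::'a \<Rightarrow> int. \<Sum>b\<in>B. of_int (k b) *\<^sub>R b)"
    using assms unfolding lattice_def by blast
  have "finite B"
    using B by (rule independent_imp_finite)
  have "\<exists>C. \<forall>k::'a \<Rightarrow> int. real_of_int \<bar>k b\<bar> \<le> C * norm (\<Sum>b\<in>B. of_int (k b) *\<^sub>R b)" if b: "b \<in> B" for b
  proof -
    \<comment> \<open>\<open>p\<close> is the dual functional of \<open>b\<close>: it reads off the
      coordinate at \<open>b\<close>.\<close>
    obtain p :: "'a \<Rightarrow> real" where p: "linear p" "\<forall>x\<in>B. p x = (if x = b then 1 else 0)"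
      using linear_independent_extend[OF B, of "\<lambda>x. if x = b then 1 else 0"] by blast
    obtain C where C: "\<And>x. norm (p x) \<le> C * norm x"
      using linear_bounded[OF p(1)] by blast
    have "p (\<Sum>c\<in>B. of_int (k c) *\<^sub>R c) = of_int (k b)" for k :: "'a \<Rightarrow> int"
    proof -
      have "p (\<Sum>c\<in>B. of_int (k c) *\<^sub>R c) = (\<Sum>c\<in>B. of_int (k c) * p c)"
        by (simp add: linear_sum[OF p(1)] linear_cmul[OF p(1)])
      also have "\<dots> = (\<Sum>c\<in>B. if c = b then of_int (k c) else 0)"
        using p(2) by (intro sum.cong) auto
      finally show ?thesis
        using \<open>finite B\<close> b by simp
    qed
    then show ?thesis
      using C by (metis of_int_abs real_norm_def)
  qed
  then obtain C where C: "\<And>b k. b \<in> B \<Longrightarrow> real_of_int \<bar>k b\<bar> \<le> C b * norm (\<Sum>b\<in>B. of_int (k b) *\<^sub>R b)"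
    by metis
  \<comment> \<open>The constants \<open>C b\<close> come without a sign; the absolute value makes
    the bound monotone in the norm of the lattice point.\<close>
  define I where "I b = {- \<lceil>\<bar>C b\<bar> * r\<rceil> .. \<lceil>\<bar>C b\<bar> * r\<rceil>}" for b
  have "{l \<in> L. norm l \<le> r} \<subseteq> (\<lambda>k. \<Sum>b\<in>B. of_int (k b) *\<^sub>R b) ` (\<Pi>\<^sub>E b\<in>B. I b)"
  proof
    fix l
    assume "l \<in> {l \<in> L. norm l \<le> r}"
    then obtain k :: "'a \<Rightarrow> int" where l: "l = (\<Sum>b\<in>B. of_int (k b) *\<^sub>R b)" and r: "norm l \<le> r"
      unfolding L by blast
    have "k b \<in> I b" if "b \<in> B" for b
    proof -
      have "real_of_int \<bar>k b\<bar> \<le> C b * norm l"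
        using C[OF that] l by blast
      also have "\<dots> \<le> \<bar>C b\<bar> * r"
        using r by (intro mult_mono) auto
      finally have "\<bar>k b\<bar> \<le> \<lceil>\<bar>C b\<bar> * r\<rceil>"
        by linarith
      then show ?thesis
        unfolding I_def atLeastAtMost_iff by linarith
    qed
    \<comment> \<open>\<open>k\<close> is arbitrary off \<open>B\<close>; its restriction represents
      the same lattice point and lies in a finite set of extensional functions.\<close>
    then have "restrict k B \<in> (\<Pi>\<^sub>E b\<in>B. I b)"
      by auto
    moreover have "l = (\<Sum>b\<in>B. of_int (restrict k B b) *\<^sub>R b)"
      unfolding l by (intro sum.cong) auto
    ultimately show "l \<in> (\<lambda>k. \<Sum>b\<in>B. of_int (k b) *\<^sub>R b) ` (\<Pi>\<^sub>E b\<in>B. I b)"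
      by blast
  qed
  moreover have "finite (\<Pi>\<^sub>E b\<in>B. I b)"
    using \<open>finite B\<close> by (intro finite_PiE) (simp_all add: I_def)
  ultimately show ?thesis
    by (meson finite_surj)
qed

section \<open>Displacements and the two matrices\<close>

lemma l2fun_heis:
  assumes \<phi>: "l2fun \<phi>"
  shows "l2fun (heis \<eta> l \<phi>)"
proof -
  have "l2fun (\<lambda>x. \<phi> (x - fst l))"
    using l2fun_affine[OF \<phi>, of 1 "- fst l"] by simp
  then show ?thesis
    unfolding heis_def[abs_def] by (rule l2fun_unimodular) simp_all
qed

text \<open>In terms of \<open>cis\<close>, an identity between products of phases reduces to a
  linear identity between real exponents.\<close>

lemma exp_i_times_eq_cis:
  "exp (\<i> * complex_of_real r) = cis r" "exp (- \<i> * complex_of_real r) = cis (- r)"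
  by (simp_all add: cis_conv_exp)

text \<open>Shifting Y by the difference of the two position shifts makes both arguments of \<phi>
  symmetric about X minus the mean position. The phases left over shift P by the mean momentum, and
  the rest is independent of Y.\<close>

lemma wigner_heis:
  fixes \<phi> :: "real^'n \<Rightarrow> complex"
  assumes \<eta>: "\<eta> \<noteq> 0" and [measurable]: "\<phi> \<in> borel_measurable borel"
  shows "wigner \<eta> (heis \<eta> l \<phi>) (heis \<eta> m \<phi>) (fst z) (snd z)
    = exp (- \<i> * complex_of_real (sympl l m / (2 * \<eta>))) * exp (- \<i> * complex_of_real (sympl z (l - m) / \<eta>))
      * wig \<eta> \<phi> (z - (1/2) *\<^sub>R (l + m))"
proof -
  let ?X = "fst z" and ?P = "snd z" and ?t = "fst l - fst m"
  let ?G = "\<lambda>Y. exp (- \<i> * complex_of_real ((?P \<bullet> Y) / \<eta>)) * heis \<eta> l \<phi> (?X + (1/2) *\<^sub>R Y)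
      * cnj (heis \<eta> m \<phi> (?X - (1/2) *\<^sub>R Y))"
  let ?X' = "?X - (1/2) *\<^sub>R (fst l + fst m)" and ?P' = "?P - (1/2) *\<^sub>R (snd l + snd m)"
  let ?c = "exp (- \<i> * complex_of_real (sympl l m / (2 * \<eta>))) * exp (- \<i> * complex_of_real (sympl z (l - m) / \<eta>))"
  have G: "?G (?t + Y) = ?c * (exp (- \<i> * complex_of_real ((?P' \<bullet> Y) / \<eta>))
      * \<phi> (?X' + (1/2) *\<^sub>R Y) * cnj (\<phi> (?X' - (1/2) *\<^sub>R Y)))" for Y
  proof -
    have 1: "?X + (1/2) *\<^sub>R (?t + Y) - fst l = ?X' + (1/2) *\<^sub>R Y"
      and 2: "?X - (1/2) *\<^sub>R (?t + Y) - fst m = ?X' - (1/2) *\<^sub>R Y"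
      by (simp_all add: vec_eq_iff field_simps)
    \<comment> \<open>The terms are the Fourier phase and the phases of the two displacements, the
      second with opposite sign owing to the conjugation.\<close>
    have "- ((?P \<bullet> (?t + Y)) / \<eta>)
        + (snd l \<bullet> (?X + (1/2) *\<^sub>R (?t + Y)) - (1/2) * (snd l \<bullet> fst l)) / \<eta>
        - (snd m \<bullet> (?X - (1/2) *\<^sub>R (?t + Y)) - (1/2) * (snd m \<bullet> fst m)) / \<eta>
      = - (sympl l m / (2 * \<eta>)) - sympl z (l - m) / \<eta> - (?P' \<bullet> Y) / \<eta>"
      using \<eta> by (simp add: sympl_def inner_diff_left inner_diff_right inner_add_left inner_add_right field_simps)
    then have "cis (- ((?P \<bullet> (?t + Y)) / \<eta>))
        * cis ((snd l \<bullet> (?X + (1/2) *\<^sub>R (?t + Y)) - (1/2) * (snd l \<bullet> fst l)) / \<eta>)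
        * cis (- ((snd m \<bullet> (?X - (1/2) *\<^sub>R (?t + Y)) - (1/2) * (snd m \<bullet> fst m)) / \<eta>))
      = cis (- (sympl l m / (2 * \<eta>))) * cis (- (sympl z (l - m) / \<eta>)) * cis (- ((?P' \<bullet> Y) / \<eta>))"
      unfolding cis_mult by (simp only: diff_conv_add_uminus)
    moreover have "u * (v * x) * (w * y) = p * q * (r * x * y)" if "u * v * w = p * q * r"
      for u v w p q r x y :: complex
    proof -
      have "u * (v * x) * (w * y) = (u * v * w) * (x * y)"
        by (simp only: mult_ac)
      then show ?thesis
        unfolding that by (simp only: mult_ac)
    qed
    ultimately show ?thesis
      unfolding heis_def exp_i_times_eq_cis 1 2 complex_cnj_mult cis_cnj by blast
  qed
  have [measurable]: "heis \<eta> k \<phi> \<in> borel_measurable borel" for k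
    unfolding heis_def[abs_def] by measurable
  have "integral\<^sup>L lborel ?G = (\<integral>Y. ?G (?t + Y) \<partial>lborel)"
    using integral_lborel_affine[of ?G 1 ?t] by simp
  also have "\<dots> = ?c * (\<integral>Y. exp (- \<i> * complex_of_real ((?P' \<bullet> Y) / \<eta>))
      * \<phi> (?X' + (1/2) *\<^sub>R Y) * cnj (\<phi> (?X' - (1/2) *\<^sub>R Y)) \<partial>lborel)"
    by (simp only: G integral_mult_right_zero)
  finally show ?thesis
    unfolding wig_def wigner_def
    by (simp only: fst_diff snd_diff fst_scaleR snd_scaleR fst_add snd_add mult.left_commute)
qed

lemma matM_eq_weyl_sesq:
  fixes \<phi> :: "real^'n \<Rightarrow> complex"
  assumes "\<eta> \<noteq> 0" and "\<phi> \<in> borel_measurable borel"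
  shows "matM \<eta> a \<phi> l m = weyl_sesq \<eta> (\<lambda>z. complex_of_real (a z)) (heis \<eta> l \<phi>) (heis \<eta> m \<phi>)"
proof -
  have "weyl_sesq \<eta> (\<lambda>z. complex_of_real (a z)) (heis \<eta> l \<phi>) (heis \<eta> m \<phi>)
      = (\<integral>z. exp (- \<i> * complex_of_real (sympl l m / (2 * \<eta>))) *
          (exp (- \<i> * complex_of_real (sympl z (l - m) / \<eta>)) * complex_of_real (a z)
            * wig \<eta> \<phi> (z - (1/2) *\<^sub>R (l + m))) \<partial>lborel)"
    unfolding weyl_sesq_def by (simp only: wigner_heis[OF assms] mult_ac)
  then show ?thesis
    unfolding matM_def coef_a_def by (simp only: integral_mult_right_zero)
qed

text \<open>The point (l + m) / 4 is forced by the reflection: with z = (l + m) / 4 + Y / 2, the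
  argument of the reflected W \<phi> becomes z - (l + m) / 2. The constant is the prefactor (2 pi
  \<eta>)^(-2n) times 2^(2n) from the substitution, and its even exponent makes it positive for
  either sign of \<eta>.\<close>

lemma matM'_eq_matM:
  fixes \<phi> :: "real^'n \<Rightarrow> complex"
  assumes \<eta>: "\<eta> \<noteq> 0" and \<phi>[measurable]: "\<phi> \<in> borel_measurable borel"
    and a: "(\<lambda>z. complex_of_real (a z)) \<in> borel_measurable borel"
  shows "matM' \<eta> a \<phi> l m = complex_of_real ((1 / (pi * \<eta>)\<^sup>2) ^ CARD('n)) * matM \<eta> a \<phi> l m"
proof -
  let ?X = "(1/4) *\<^sub>R (l + m)"
  let ?e = "exp (- \<i> * complex_of_real (sympl l m / (2 * \<eta>)))"
  define H where "H z = exp (- \<i> * complex_of_real (sympl z (l - m) / \<eta>)) * complex_of_real (a z)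
      * wig \<eta> \<phi> (z - (1/2) *\<^sub>R (l + m))" for z
  have wig: "wig \<eta> \<phi> \<in> borel_measurable borel"
    using wigner_measurable[OF \<phi> \<phi>, of \<eta>] by (simp add: wig_def[abs_def] borel_prod)
  have [measurable]: "H \<in> borel_measurable borel"
    unfolding H_def
  proof (intro borel_measurable_times a)
    show "(\<lambda>z. exp (- \<i> * complex_of_real (sympl z (l - m) / \<eta>))) \<in> borel_measurable borel"
      unfolding sympl_def by (intro borel_measurable_continuous_onI continuous_intros) (use \<eta> in auto)
    show "(\<lambda>z. wig \<eta> \<phi> (z - (1/2) *\<^sub>R (l + m))) \<in> borel_measurable borel"
      by (rule measurable_compose[OF _ wig]) simp
  qed
  have eq: "exp (- \<i> * complex_of_real ((((1/2) *\<^sub>R symp_J (m - l)) \<bullet> Y) / \<eta>)) * complex_of_real (a (?X + (1/2) *\<^sub>R Y))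
      * cnj (wig \<eta> \<phi> (- (?X - (1/2) *\<^sub>R Y))) = ?e * H (?X + (1/2) *\<^sub>R Y)" for Y
  proof -
    have 1: "- (?X - (1/2) *\<^sub>R Y) = ?X + (1/2) *\<^sub>R Y - (1/2) *\<^sub>R (l + m)"
      by (simp add: prod_eq_iff vec_eq_iff field_simps)
    \<comment> \<open>The constant part of the last term is sigma((l + m) / 4, l - m) = - sigma(l,
      m) / 2, which cancels the first term; what remains is sigma(Y, l - m) / (2 \<eta>).\<close>
    have "(((1/2) *\<^sub>R symp_J (m - l)) \<bullet> Y) / \<eta> = sympl l m / (2 * \<eta>) + sympl (?X + (1/2) *\<^sub>R Y) (l - m) / \<eta>"
      using \<eta> by (simp add: symp_J_def sympl_def inner_prod_def inner_diff_left inner_diff_right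
          inner_add_left inner_add_right inner_commute field_simps)
    then have 2: "exp (- \<i> * complex_of_real ((((1/2) *\<^sub>R symp_J (m - l)) \<bullet> Y) / \<eta>))
        = ?e * exp (- \<i> * complex_of_real (sympl (?X + (1/2) *\<^sub>R Y) (l - m) / \<eta>))"
      by (simp only: exp_i_times_eq_cis cis_mult minus_add_distrib)
    have 3: "cnj (wig \<eta> \<phi> z) = wig \<eta> \<phi> z" for z
      by (simp add: wig_def cnj_wigner)
    show ?thesis
      unfolding 1 2 3 H_def by (simp only: mult.assoc)
  qed
  have "integral\<^sup>L lborel H = (1/2) ^ (2 * CARD('n)) *\<^sub>R (\<integral>Y. H (?X + (1/2) *\<^sub>R Y) \<partial>lborel)"
    using integral_lborel_affine[of H "1/2" ?X] by (simp add: mult_2)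
  then have int: "(\<integral>Y. H (?X + (1/2) *\<^sub>R Y) \<partial>lborel) = complex_of_real (2 ^ (2 * CARD('n))) * integral\<^sup>L lborel H"
    by (simp add: scaleR_conv_of_real power_one_over field_simps)
  have dim: "DIM((real^'n) \<times> (real^'n)) = 2 * CARD('n)"
    by simp
  have "matM' \<eta> a \<phi> l m = 1 / complex_of_real ((2 * pi * \<eta>) ^ (2 * CARD('n))) *
      (?e * (complex_of_real (2 ^ (2 * CARD('n))) * integral\<^sup>L lborel H))"
    unfolding matM'_def wigner_def eq integral_mult_right_zero int dim ..
  also have "integral\<^sup>L lborel H = coef_a \<eta> a \<phi> l m"
    unfolding coef_a_def H_def ..
  finally have "matM' \<eta> a \<phi> l m
      = complex_of_real (2 ^ (2 * CARD('n)) / (2 * pi * \<eta>) ^ (2 * CARD('n))) * matM \<eta> a \<phi> l m"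
    unfolding matM_def of_real_divide by (simp del: of_real_power of_real_mult)
  also have "2 ^ (2 * CARD('n)) / (2 * pi * \<eta>) ^ (2 * CARD('n)) = (1 / (pi * \<eta>)\<^sup>2) ^ CARD('n)"
  proof -
    have "2 / (2 * pi * \<eta>) = 1 / (pi * \<eta>)"
      by simp
    then show ?thesis
      unfolding power_divide[symmetric] power_mult by (simp only: power_divide power_one)
  qed
  finally show ?thesis .
qed

text \<open>Expanding the Weyl form of a combination sesquilinearly gives the quadratic form of the
  matrix with the same coefficients. For infinite \<open>S\<close> both sums default to 0, so the
  expansion is still consistent.\<close>

lemma psd_on_matM_iff:
  fixes \<phi> :: "real^'n \<Rightarrow> complex"
  assumes \<eta>: "\<eta> \<noteq> 0" and \<phi>: "l2fun \<phi>" and a: "l2fun (\<lambda>z. complex_of_real (a z))"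
  shows "psd_on S (matM \<eta> a \<phi>) \<longleftrightarrow>
    (\<forall>\<zeta>. cnonneg (weyl_form \<eta> (\<lambda>z. complex_of_real (a z)) (\<lambda>x. \<Sum>l\<in>S. \<zeta> l * heis \<eta> l \<phi> x)))"
proof -
  let ?a = "\<lambda>z. complex_of_real (a z)"
  have "weyl_form \<eta> ?a (\<lambda>x. \<Sum>l\<in>S. \<zeta> l * heis \<eta> l \<phi> x) = (\<Sum>l\<in>S. \<Sum>m\<in>S. \<zeta> l * cnj (\<zeta> m) * matM \<eta> a \<phi> l m)" for \<zeta>
  proof -
    have v: "l2fun (\<lambda>x. \<Sum>l\<in>S. \<zeta> l * heis \<eta> l \<phi> x)"
      by (intro l2fun_sum l2fun_cmult l2fun_heis \<phi>)
    have "weyl_form \<eta> ?a (\<lambda>x. \<Sum>l\<in>S. \<zeta> l * heis \<eta> l \<phi> x)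
        = (\<Sum>l\<in>S. \<zeta> l * (\<Sum>m\<in>S. cnj (\<zeta> m) * weyl_sesq \<eta> ?a (heis \<eta> l \<phi>) (heis \<eta> m \<phi>)))"
      unfolding weyl_form_eq_sesq
      by (subst weyl_sesq_sum_left[OF \<eta> a l2fun_heis[OF \<phi>] v])
         (simp add: weyl_sesq_sum_right[OF \<eta> a] l2fun_heis[OF \<phi>])
    then show ?thesis
      by (simp add: matM_eq_weyl_sesq[OF \<eta> l2fun_borel_measurable[OF \<phi>]] sum_distrib_left mult.assoc)
  qed
  then show ?thesis
    by (simp add: psd_on_def)
qed

section \<open>Nonnegativity tested on finite sections\<close>

lemma weyl_nonneg_iff_psd:
  fixes \<phi> :: "real^'n \<Rightarrow> complex"
  assumes \<eta>: "\<eta> \<noteq> 0" and \<Lambda>: "lattice \<Lambda>" and \<phi>: "l2fun \<phi>" and frame: "gabor_frame \<eta> \<phi> \<Lambda>"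
    and a: "l2fun (\<lambda>z. complex_of_real (a z))"
  shows "weyl_nonneg \<eta> (\<lambda>z. complex_of_real (a z)) \<longleftrightarrow>
    (\<forall>N::nat. psd_on {l \<in> \<Lambda>. norm l \<le> real N} (matM \<eta> a \<phi>))"
proof
  assume "weyl_nonneg \<eta> (\<lambda>z. complex_of_real (a z))"
  then show "\<forall>N::nat. psd_on {l \<in> \<Lambda>. norm l \<le> real N} (matM \<eta> a \<phi>)"
    unfolding psd_on_matM_iff[OF \<eta> \<phi> a] weyl_nonneg_def
    using l2fun_sum[of _ "\<lambda>l x. _ l * heis \<eta> l \<phi> x"] l2fun_cmult[OF l2fun_heis[OF \<phi>]] by blast
next
  let ?a = "\<lambda>z. complex_of_real (a z)"
  assume psd: "\<forall>N::nat. psd_on {l \<in> \<Lambda>. norm l \<le> real N} (matM \<eta> a \<phi>)"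
  have span: "cnonneg (weyl_form \<eta> ?a (\<lambda>x. \<Sum>l\<in>F. \<zeta> l * heis \<eta> l \<phi> x))" if F: "finite F" "F \<subseteq> \<Lambda>" for F \<zeta>
  proof -
    obtain R where R: "\<And>l. l \<in> F \<Longrightarrow> norm l \<le> R"
      using finite_imp_bounded[OF F(1)] unfolding bounded_iff by blast
    \<comment> \<open>A ball of integer radius containing \<open>F\<close>; \<open>nat\<close> sends
      a negative ceiling, possible when \<open>F\<close> is empty, to radius 0. Coefficients are
      then padded by zero from \<open>F\<close> to the whole ball.\<close>
    define S where "S = {l \<in> \<Lambda>. norm l \<le> real (nat \<lceil>R\<rceil>)}"
    have "norm l \<le> real (nat \<lceil>R\<rceil>)" if "l \<in> F" for l
      using R[OF that] real_nat_ceiling_ge[of R] by linarith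
    then have S: "finite S" "F \<subseteq> S"
      using F lattice_finite_norm_le[OF \<Lambda>] unfolding S_def by blast+
    have "(\<Sum>l\<in>F. \<zeta> l * heis \<eta> l \<phi> x) = (\<Sum>l\<in>S. (if l \<in> F then \<zeta> l else 0) * heis \<eta> l \<phi> x)" for x
      using S by (intro sum.mono_neutral_cong_left) auto
    then show ?thesis
      using psd unfolding psd_on_matM_iff[OF \<eta> \<phi> a] S_def by simp
  qed
  obtain A B where A: "0 < A" and AB: "A \<le> B"
    and bounds: "\<And>f. l2fun f \<Longrightarrow> (\<lambda>l. (cmod (l2_inner f (heis \<eta> l \<phi>)))\<^sup>2) summable_on \<Lambda>"
      "\<And>f. l2fun f \<Longrightarrow> A * l2_normsq f \<le> (\<Sum>\<^sub>\<infinity>l\<in>\<Lambda>. (cmod (l2_inner f (heis \<eta> l \<phi>)))\<^sup>2)"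
      "\<And>f. l2fun f \<Longrightarrow> (\<Sum>\<^sub>\<infinity>l\<in>\<Lambda>. (cmod (l2_inner f (heis \<eta> l \<phi>)))\<^sup>2) \<le> B * l2_normsq f"
    using frame unfolding gabor_frame_def by auto
  have B: "0 < B"
    using A AB by simp
  show "weyl_nonneg \<eta> ?a"
    unfolding weyl_nonneg_def
  proof (intro allI impI)
    fix \<psi> :: "real^'n \<Rightarrow> complex"
    assume \<psi>: "l2fun \<psi>"
    have "\<exists>v. l2fun v \<and> cnonneg (weyl_form \<eta> ?a v) \<and> l2_normsq (\<lambda>x. \<psi> x - v x) < inverse (real (Suc k))" for k
    proof -
      have pos: "inverse (real (Suc k)) > 0"
        by simp
      obtain F \<zeta> where F: "finite F" "F \<subseteq> \<Lambda>"
        and "l2_normsq (\<lambda>x. \<psi> x - (\<Sum>l\<in>F. \<zeta> l * heis \<eta> l \<phi> x)) < inverse (real (Suc k))"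
        by (rule frame_span_dense[where e = "\<lambda>l. heis \<eta> l \<phi>", OF l2fun_heis[OF \<phi>] A B bounds \<psi> pos])
      moreover have "l2fun (\<lambda>x. \<Sum>l\<in>F. \<zeta> l * heis \<eta> l \<phi> x)"
        by (intro l2fun_sum l2fun_cmult l2fun_heis \<phi>)
      ultimately show ?thesis
        using span[OF F] by blast
    qed
    then obtain v where v: "\<And>k. l2fun (v k)" and nn: "\<And>k. cnonneg (weyl_form \<eta> ?a (v k))"
      and close: "\<And>k. l2_normsq (\<lambda>x. \<psi> x - v k x) < inverse (real (Suc k))"
      by metis
    have "(\<lambda>k. l2_normsq (\<lambda>x. \<psi> x - v k x)) \<longlonglongrightarrow> 0"
      by (rule tendsto_sandwich[OF _ _ tendsto_const LIMSEQ_inverse_real_of_nat])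
         (intro always_eventually allI less_imp_le[OF close] l2_normsq_nonneg)+
    then have lim: "(\<lambda>k. weyl_form \<eta> ?a (v k)) \<longlonglongrightarrow> weyl_form \<eta> ?a \<psi>"
      unfolding weyl_form_eq_sesq by (rule tendsto_weyl_sesq[OF \<eta> a \<psi> v])
    \<comment> \<open>Closedness of the nonnegative reals in the complex plane: the imaginary parts
      are constantly 0 and the real parts are nonnegative along the sequence, so both properties
      pass to the limit.\<close>
    have "(\<lambda>k. Im (weyl_form \<eta> ?a (v k))) \<longlonglongrightarrow> Im (weyl_form \<eta> ?a \<psi>)"
      by (rule tendsto_Im[OF lim])
    then have "Im (weyl_form \<eta> ?a \<psi>) = 0"
      using nn by (simp add: cnonneg_def LIMSEQ_const_iff)
    moreover have "0 \<le> Re (weyl_form \<eta> ?a \<psi>)"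
      by (rule LIMSEQ_le_const[OF tendsto_Re[OF lim]]) (use nn in \<open>auto simp: cnonneg_def\<close>)
    ultimately show "cnonneg (weyl_form \<eta> ?a \<psi>)"
      by (simp add: cnonneg_def)
  qed
qed

lemma psd_on_cmult_iff:
  assumes c: "c > 0" and eq: "\<And>l m. l \<in> S \<Longrightarrow> m \<in> S \<Longrightarrow> M' l m = complex_of_real c * M l m"
  shows "psd_on S M' \<longleftrightarrow> psd_on S M"
proof -
  have "(\<Sum>l\<in>S. \<Sum>m\<in>S. \<zeta> l * cnj (\<zeta> m) * M' l m)
      = complex_of_real c * (\<Sum>l\<in>S. \<Sum>m\<in>S. \<zeta> l * cnj (\<zeta> m) * M l m)" for \<zeta>
    unfolding sum_distrib_left by (intro sum.cong refl) (simp add: eq mult_ac)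
  then show ?thesis
    using c by (simp add: psd_on_def cnonneg_def zero_le_mult_iff)
qed

theorem mainTheorem2:
  fixes \<eta> :: real
    and \<Lambda> :: "((real^'n) \<times> (real^'n)) set"
    and \<phi> :: "(real^'n) \<Rightarrow> complex"
    and a :: "(real^'n) \<times> (real^'n) \<Rightarrow> real"
  assumes "\<eta> \<noteq> 0"
    and "lattice \<Lambda>"
    and "l2fun \<phi>"
    and "gabor_frame \<eta> \<phi> \<Lambda>"
    and "l2fun (\<lambda>z. complex_of_real (a z))"
  shows "(weyl_nonneg \<eta> (\<lambda>z. complex_of_real (a z)) \<longleftrightarrow>
            (\<forall>N::nat. psd_on {l \<in> \<Lambda>. norm l \<le> real N} (matM \<eta> a \<phi>)))
       \<and> (weyl_nonneg \<eta> (\<lambda>z. complex_of_real (a z)) \<longleftrightarrow>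
            (\<forall>N::nat. psd_on {l \<in> \<Lambda>. norm l \<le> real N} (matM' \<eta> a \<phi>)))
       \<and> (\<exists>c::real. 0 < c \<and> (\<forall>l\<in>\<Lambda>. \<forall>m\<in>\<Lambda>. matM' \<eta> a \<phi> l m = complex_of_real c * matM \<eta> a \<phi> l m))"
proof -
  define c :: real where "c = (1 / (pi * \<eta>)\<^sup>2) ^ CARD('n)"
  have c: "c > 0"
    using \<open>\<eta> \<noteq> 0\<close> by (simp add: c_def)
  have M': "matM' \<eta> a \<phi> l m = complex_of_real c * matM \<eta> a \<phi> l m" for l m
    unfolding c_def using assms(1,3,5) by (intro matM'_eq_matM l2fun_borel_measurable)
  have "psd_on S (matM' \<eta> a \<phi>) \<longleftrightarrow> psd_on S (matM \<eta> a \<phi>)" for S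
    by (rule psd_on_cmult_iff[OF c M'])
  then show ?thesis
    using weyl_nonneg_iff_psd[OF assms] c M' by blast
qed

end
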